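(* Let $n\ge 4$ and let $p$ be a real number with $p>\frac{2(n-1)}{n-3}$. For $f$ on $\mathbb{R}^n$ let $u(x,t)$ be the solution of the Cauchy problem for the wave equation $$\left(\partial_t^2-\Delta\right)u=0,\qquad u|_{t=0}=0,\qquad \partial_t u|_{t=0}=f$$ in $\mathbb{R}^n\times\mathbb{R}$. Then the estimate $$\left\|\sup_{t>0}\left|\frac{u(x,t)}{t}\right|\right\|_{L^p(\mathbb{R}^n)}\le C_p\|f\|_{L^p(\mathbb{R}^n)}$$ cannot hold; that is, there is no finite constant $C_p$ for which it is true for all $f$.
   Context: The estimate is understood as an a priori inequality for all Schwartz functions $f$ on $\mathbb{R}^n$; the $L^p$ norm on the left is taken in the variable $x$. *)

theory Defs
  imports "HOL-Analysis.Analysis"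
begin

definition partial_deriv ::
    "'a::real_normed_vector \<Rightarrow> ('a \<Rightarrow> 'b::real_normed_vector) \<Rightarrow> 'a \<Rightarrow> 'b" where
  "partial_deriv b f x = frechet_derivative f (at x) b"

primrec C_k :: "nat \<Rightarrow> ('a::euclidean_space \<Rightarrow> 'b::real_normed_vector) \<Rightarrow> bool" where
  "C_k 0 f \<longleftrightarrow> continuous_on UNIV f"
| "C_k (Suc k) f \<longleftrightarrow> f differentiable_on UNIV \<and> (\<forall>b\<in>Basis. C_k k (partial_deriv b f))"

text \<open>A list of basis vectors plays the role of the multi-index of the derivative.  The
  weights \<open>norm x ^ k\<close> give the same space as the monomial weights.\<close>

definition schwartz :: "('a::euclidean_space \<Rightarrow> 'b::real_normed_vector) \<Rightarrow> bool" where
  "schwartz f \<longleftrightarrow> (\<forall>k. C_k k f) \<and>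
     (\<forall>bs k. set bs \<subseteq> Basis \<longrightarrow>
        bounded (range (\<lambda>x. norm x ^ k *\<^sub>R foldr partial_deriv bs f x)))"

definition laplacian :: "('a::euclidean_space \<Rightarrow> 'b::real_normed_vector) \<Rightarrow> 'a \<Rightarrow> 'b" where
  "laplacian g x = (\<Sum>b\<in>Basis. partial_deriv b (partial_deriv b g) x)"

definition time_deriv :: "('a \<Rightarrow> real \<Rightarrow> 'b::real_normed_vector) \<Rightarrow> 'a \<Rightarrow> real \<Rightarrow> 'b" where
  "time_deriv u x t = vector_derivative (u x) (at t)"

text \<open>Classical solutions: jointly \<open>C\<^sup>2\<close> on all of space-time.  By finite speed of propagation
  there is at most one for given data.\<close>

definition wave_solution ::
    "('a::euclidean_space \<Rightarrow> 'b::real_normed_vector) \<Rightarrow> ('a \<Rightarrow> real \<Rightarrow> 'b) \<Rightarrow> bool" where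
  "wave_solution f u \<longleftrightarrow>
     C_k 2 (\<lambda>(x, t). u x t) \<and>
     (\<forall>x t. time_deriv (time_deriv u) x t - laplacian (\<lambda>y. u y t) x = 0) \<and>
     (\<forall>x. u x 0 = 0) \<and>
     (\<forall>x. time_deriv u x 0 = f x)"

text \<open>Real powers on \<open>[0, \<infinity>]\<close>, intended for exponents \<open>a > 0\<close>.\<close>

definition ennreal_powr :: "ennreal \<Rightarrow> real \<Rightarrow> ennreal" where
  "ennreal_powr y a = (if y = top then top else ennreal (enn2real y powr a))"

definition Lp_norm :: "real \<Rightarrow> ('a::euclidean_space \<Rightarrow> ennreal) \<Rightarrow> ennreal" where
  "Lp_norm p g = ennreal_powr (\<integral>\<^sup>+ x. ennreal_powr (g x) p \<partial>lborel) (1 / p)"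

end

theory Submission
  imports Defs "HOL-Real_Asymp.Real_Asymp"
begin

text \<open>
  A wave that focuses at the origin at time \<open>T\<close> defeats the estimate already at the single
  time \<open>t = T\<close>.  Near the origin \<open>u(x,T)\<close> is bounded below, so the left-hand side is at least
  of order \<open>1 / T\<close>.  The data live near the sphere \<open>|x| = T\<close>, in a shell of width \<open>O(1)\<close>, and have
  size \<open>T^(-(n-1)/2)\<close> there, so that \<open>T \<parallel>f\<parallel>\<^sub>p\<close> is of order \<open>T^(1 - (n-1)/2 + (n-1)/p)\<close>, which tends
  to 0 exactly when \<open>p > 2(n-1)/(n-3)\<close>.

  The waves are superpositions over the frequency \<open>l > 0\<close> of \<open>exp(itl)\<close> times the radial
  eigenfunction of the Laplacian for the eigenvalue \<open>-l\<^sup>2\<close>.  The weight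
  \<open>exp(-(l + 1/l))\<close> is flat at 0 and at infinity, so integration by parts in \<open>l\<close> has no
  boundary terms; it yields the Schwartz decay in \<open>x\<close>, the decay in \<open>t\<close>, and the
  concentration near the light cone, in every dimension at once.
\<close>

section \<open>Normalized Bessel functions\<close>

text \<open>The waves form an algebra with two labels, the Bessel parameter \<open>a\<close> and the
  exponent \<open>k\<close> of a factor \<open>l powi k\<close>. In the variable |x|^2 they are
  smooth at the origin, each derivative raises \<open>a\<close> by 1, and two relations between
  neighbouring labels, the Bessel recurrence and integration by parts in \<open>l\<close>, take the
  place of asymptotic expansions. Negative \<open>k\<close> must be allowed because differentiating
  the weight produces 1/l^2. The obstacle is uniformity in T. At each fixed time the data are
  Schwartz, but with constants that may depend on T. Uniform bounds come from multiplying by r^2 -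
  T^2, where the worst terms cancel. The price is a shell with a tail of first order only, 1/(1 + |r
  - T|); as p > 1, this is still p-integrable across the shell. At the origin the factor
  r^(-(n-1)/2) is not p-integrable, and decay in T takes over. The threshold for p enters at |x| >
  T/2; the inner region asks only for p > 2n/(n-1).\<close>

definition bessel_coeff :: "real \<Rightarrow> nat \<Rightarrow> real" where
  "bessel_coeff a i = (- 1 / 4) ^ i / (fact i * pochhammer a i)"

text \<open>In terms of the usual Bessel functions, \<open>nbessel a (r\<^sup>2) = \<Gamma>(a) (2 / r)\<^sup>a\<^sup>-\<^sup>1 J\<^sub>a\<^sub>-\<^sub>1(r)\<close>.\<close>

definition nbessel :: "real \<Rightarrow> real \<Rightarrow> real" where
  "nbessel a z = (\<Sum>i. bessel_coeff a i * z ^ i)"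

lemma pochhammer_ge_1: "1 \<le> pochhammer a i" if "1 \<le> a" for a :: real
  using that
proof (induction i)
  case (Suc i)
  then have "1 * 1 \<le> pochhammer a i * (a + real i)"
    by (intro mult_mono) auto
  then show ?case by (simp add: pochhammer_Suc)
qed simp

lemma summable_bessel_coeff:
  assumes "1 \<le> a"
  shows "summable (\<lambda>i. bessel_coeff a i * z ^ i)"
proof (rule summable_comparison_test)
  show "summable (\<lambda>i. inverse (fact i) * \<bar>z\<bar> ^ i)"
    by (rule summable_exp)
  have "norm (bessel_coeff a i * z ^ i) \<le> inverse (fact i) * \<bar>z\<bar> ^ i" for i
  proof -
    have "(1 / 4) ^ i \<le> (1 :: real)"
      by (rule power_le_one) auto
    then have "(1 / 4) ^ i / (fact i * pochhammer a i) \<le> 1 / (fact i * 1)"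
      using pochhammer_ge_1[OF assms, of i] by (intro frac_le mult_left_mono) auto
    moreover have "norm (bessel_coeff a i) = (1 / 4) ^ i / (fact i * pochhammer a i)"
      using pochhammer_ge_1[OF assms, of i]
      by (simp add: bessel_coeff_def abs_mult power_abs)
    ultimately have "norm (bessel_coeff a i) \<le> inverse (fact i)"
      by (simp add: inverse_eq_divide)
    then show ?thesis
      by (simp add: abs_mult power_abs mult_right_mono)
  qed
  then show "\<exists>N. \<forall>i\<ge>N. norm (bessel_coeff a i * z ^ i) \<le> inverse (fact i) * \<bar>z\<bar> ^ i"
    by blast
qed

text \<open>Splitting off the first factor \<open>a\<close> of the rising factorial turns a shift of
  the index into a shift of the parameter; this is the derivative rule on the level of
  coefficients.\<close>

lemma bessel_coeff_Suc:
  assumes "1 \<le> a"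
  shows "bessel_coeff a (Suc i) = - 1 / (4 * a) * bessel_coeff (a + 1) i / Suc i"
  using assms pochhammer_ge_1[of "a + 1" i]
  by (simp add: bessel_coeff_def pochhammer_rec divide_simps)

text \<open>In the variable r^2 the classical rule for (1/r) d/dr applied to J_nu(r) / r^nu has no
  singular factor: the parameter goes up by 1, that is, the dimension 2a goes up by 2.\<close>

lemma nbessel_has_field_derivative:
  assumes "1 \<le> a"
  shows "(nbessel a has_field_derivative - 1 / (4 * a) * nbessel (a + 1) z) (at z)"
proof -
  have "(nbessel a has_field_derivative (\<Sum>i. diffs (bessel_coeff a) i * z ^ i)) (at z)"
    unfolding nbessel_def[abs_def]
    by (rule termdiffs_strong_converges_everywhere) (rule summable_bessel_coeff[OF assms])
  also have "(\<lambda>i. diffs (bessel_coeff a) i * z ^ i)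
      = (\<lambda>i. - 1 / (4 * a) * (bessel_coeff (a + 1) i * z ^ i))"
    using bessel_coeff_Suc[OF assms] by (simp add: diffs_def)
  also have "(\<Sum>i. - 1 / (4 * a) * (bessel_coeff (a + 1) i * z ^ i))
      = - 1 / (4 * a) * nbessel (a + 1) z"
    unfolding nbessel_def by (rule suminf_mult) (use summable_bessel_coeff[of "a + 1"] assms in simp)
  finally show ?thesis .
qed

declare nbessel_has_field_derivative [THEN DERIV_chain2, derivative_intros]

lemma nbessel_0 [simp]: "nbessel a 0 = 1"
  unfolding nbessel_def by (subst powser_zero) (simp add: bessel_coeff_def)

text \<open>The three-term recurrence of the Bessel functions. Together with the derivative rule it
  encodes the Bessel differential equation.\<close>

lemma nbessel_rec:
  assumes "1 \<le> a"
  shows "z * nbessel (a + 2) z = 4 * a * (a + 1) * (nbessel (a + 1) z - nbessel a z)"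
proof -
  let ?d = "\<lambda>i. bessel_coeff (a + 1) i * z ^ i - bessel_coeff a i * z ^ i"
  have sm: "summable (\<lambda>i. bessel_coeff b i * z ^ i)" if "1 \<le> b" for b
    by (rule summable_bessel_coeff[OF that])
  have d: "summable ?d"
    using assms by (intro summable_diff sm) auto
  \<comment> \<open>The coefficients at index 0 agree, so the difference series starts at index 1
    and its shift supplies the factor \<open>z\<close>.\<close>
  have step: "?d (Suc i) = z / (4 * a * (a + 1)) * (bessel_coeff (a + 2) i * z ^ i)" for i
  proof -
    have 1: "bessel_coeff (a + 1) (Suc i) = - 1 / (4 * (a + 1)) * bessel_coeff (a + 2) i / Suc i"
      using bessel_coeff_Suc[of "a + 1" i] assms by (simp add: add.assoc)
    have 2: "bessel_coeff a (Suc i) = - 1 / (4 * a) * bessel_coeff (a + 1) i / Suc i"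
      by (rule bessel_coeff_Suc[OF assms])
    \<comment> \<open>Both sides are \<open>pochhammer (a + 1) (i + 1)\<close>, with the last or the
      first factor split off.\<close>
    have "pochhammer (a + 1) i * (a + 1 + i) = (a + 1) * pochhammer (a + 2) i"
      using pochhammer_rec[of "a + 1" i] by (simp add: pochhammer_Suc add.assoc)
    then have 3: "bessel_coeff (a + 1) i = (a + 1 + i) / (a + 1) * bessel_coeff (a + 2) i"
      using assms pochhammer_ge_1[of "a + 1" i] pochhammer_ge_1[of "a + 2" i]
      by (simp add: bessel_coeff_def divide_simps mult.commute)
    show ?thesis
      unfolding 1 2 3 using assms by (simp add: divide_simps) (simp add: algebra_simps)
  qed
  have "nbessel (a + 1) z - nbessel a z = suminf ?d"
    unfolding nbessel_def using assms by (intro suminf_diff sm) auto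
  also have "\<dots> = (\<Sum>i. ?d (Suc i))"
    using suminf_split_head[OF d] by (simp add: bessel_coeff_def)
  also have "\<dots> = z / (4 * a * (a + 1)) * nbessel (a + 2) z"
    unfolding step nbessel_def by (rule suminf_mult) (use assms in \<open>auto intro!: sm\<close>)
  finally show ?thesis
    using assms by (simp add: mult.assoc)
qed

text \<open>With z = r^2 the left-hand side is J^2 + (dJ/dr)^2 for J(r) =
  \<open>nbessel a (r\<^sup>2)\<close>, the energy of an oscillator with friction (2a - 1)/r. It
  starts at 1 and can only fall: once the recurrence has eliminated the parameter a + 2, the mixed
  terms cancel and the friction term remains.\<close>

lemma nbessel_energy:
  assumes "1 \<le> a" "0 \<le> z"
  shows "(nbessel a z)\<^sup>2 + z * (nbessel (a + 1) z)\<^sup>2 / (4 * a\<^sup>2) \<le> 1"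
proof -
  let ?E = "\<lambda>z. (nbessel a z)\<^sup>2 + z * (nbessel (a + 1) z)\<^sup>2 / (4 * a\<^sup>2)"
  have "?E z \<le> ?E 0"
  proof (rule DERIV_nonpos_imp_nonincreasing[OF assms(2)])
    fix x assume "0 \<le> x" "x \<le> z"
    define A B C where "A = nbessel a x" and "B = nbessel (a + 1) x" and "C = nbessel (a + 2) x"
    have C: "x * C = 4 * a * (a + 1) * (B - A)"
      unfolding A_def B_def C_def by (rule nbessel_rec[OF assms(1)])
    have d: "(?E has_real_derivative 2 * A * (- 1 / (4 * a) * B)
        + (B\<^sup>2 + x * (2 * B * (- 1 / (4 * (a + 1)) * C))) / (4 * a\<^sup>2)) (at x)"
      unfolding A_def B_def C_def using assms(1)
      by (auto intro!: derivative_eq_intros simp: power2_eq_square add.assoc divide_simps)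
    have "2 * A * (- 1 / (4 * a) * B) + (B\<^sup>2 + x * (2 * B * (- 1 / (4 * (a + 1)) * C))) / (4 * a\<^sup>2)
       = - A * B / (2 * a) + (B\<^sup>2 - B * (x * C) / (2 * (a + 1))) / (4 * a\<^sup>2)"
      using assms(1) by (simp add: divide_simps) (simp add: algebra_simps)
    also have "\<dots> = B\<^sup>2 * (1 - 2 * a) / (4 * a\<^sup>2)"
      unfolding C using assms(1) by (simp add: divide_simps) (simp add: algebra_simps power2_eq_square)
    also have "\<dots> \<le> 0"
      using assms(1) by (auto intro!: divide_nonpos_pos mult_nonneg_nonpos)
    finally show "\<exists>y. (?E has_real_derivative y) (at x) \<and> y \<le> 0"
      using d by blast
  qed
  then show ?thesis by simp
qed

lemma abs_nbessel_le_1: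
  assumes "1 \<le> a" "0 \<le> z"
  shows "\<bar>nbessel a z\<bar> \<le> 1"
proof -
  have "0 \<le> z * (nbessel (a + 1) z)\<^sup>2 / (4 * a\<^sup>2)"
    using assms by simp
  then have "(nbessel a z)\<^sup>2 \<le> 1"
    using nbessel_energy[OF assms] by linarith
  then show ?thesis by (simp add: abs_square_le_1)
qed

lemma continuous_on_nbessel: "1 \<le> a \<Longrightarrow> continuous_on S (nbessel a)"
  by (intro DERIV_continuous_on[OF has_field_derivative_at_within[OF nbessel_has_field_derivative]])

lemma borel_measurable_nbessel [measurable]: "1 \<le> a \<Longrightarrow> nbessel a \<in> borel_measurable borel"
  by (intro borel_measurable_continuous_onI continuous_on_nbessel)

text \<open>With \<open>J z = nbessel a (z\<^sup>2)\<close> and \<open>c = 2a - 1\<close> one has \<open>J'' + (c / z) J' + J = 0\<close>; the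
  functional \<open>z\<^sup>c (J\<^sup>2 + J'\<^sup>2 + (c / z) J J')\<close> is almost conserved for large \<open>z\<close>.\<close>

lemma nbessel_decay:
  assumes a: "1 \<le> a"
  obtains K where "0 < K" "\<And>z. 0 < z \<Longrightarrow> \<bar>nbessel a (z\<^sup>2)\<bar> \<le> K * z powr - (a - 1 / 2)"
proof -
  define c where "c = 2 * a - 1"
  have c: "1 \<le> c" using a by (simp add: c_def)
  define J where "J z = nbessel a (z\<^sup>2)" for z
  define J' where "J' z = - z / (2 * a) * nbessel (a + 1) (z\<^sup>2)" for z
  have dJ: "(J has_real_derivative J' z) (at z)" for z
    unfolding J_def J'_def using a by (auto intro!: derivative_eq_intros simp: field_simps)
  have dJ': "(J' has_real_derivative - c / z * J' z - J z) (at z)" if "0 < z" for z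
  proof -
    define A B C where "A = nbessel a (z\<^sup>2)" and "B = nbessel (a + 1) (z\<^sup>2)" and "C = nbessel (a + 2) (z\<^sup>2)"
    have C: "z\<^sup>2 * C = 4 * a * (a + 1) * (B - A)"
      unfolding A_def B_def C_def by (rule nbessel_rec[OF assms(1)])
    have "(J' has_real_derivative - 1 / (2 * a) * B + - z / (2 * a) * (- 1 / (4 * (a + 1)) * C * (2 * z))) (at z)"
      unfolding J'_def B_def C_def using a
      by (auto intro!: derivative_eq_intros simp: power2_eq_square add.assoc divide_simps) (simp add: algebra_simps)
    also have "- 1 / (2 * a) * B + - z / (2 * a) * (- 1 / (4 * (a + 1)) * C * (2 * z))
        = - 1 / (2 * a) * B + (z\<^sup>2 * C) / (4 * a * (a + 1))"
      using a by (simp add: divide_simps power2_eq_square)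
    also have "\<dots> = - 1 / (2 * a) * B + (B - A)"
      unfolding C using a by simp
    also have "\<dots> = - c / z * J' z - J z"
      unfolding J_def J'_def A_def[symmetric] B_def[symmetric] c_def using a that by (simp add: field_simps)
    finally show ?thesis .
  qed
  have J1: "\<bar>J z\<bar> \<le> 1" for z
    unfolding J_def using a by (intro abs_nbessel_le_1) auto
  have J'1: "\<bar>J' z\<bar> \<le> 1" for z
  proof -
    have "(J' z)\<^sup>2 = z\<^sup>2 * (nbessel (a + 1) (z\<^sup>2))\<^sup>2 / (4 * a\<^sup>2)"
      by (simp add: J'_def power_mult_distrib power_divide)
    moreover have "0 \<le> (nbessel a (z\<^sup>2))\<^sup>2" by simp
    ultimately have "(J' z)\<^sup>2 \<le> 1"
      using nbessel_energy[OF a zero_le_power2, of z] by linarith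
    then show ?thesis by (simp add: abs_square_le_1)
  qed
  define Q where "Q z = z powr c * ((J z)\<^sup>2 + (J' z)\<^sup>2 + c / z * J z * J' z)" for z
  define q where "q z = z powr c * ((J z)\<^sup>2 + (J' z)\<^sup>2)" for z
  have JJ: "\<bar>2 * (x * y)\<bar> \<le> x\<^sup>2 + y\<^sup>2" for x y :: real
    using sum_squares_bound[of x y] sum_squares_bound[of x "- y"] by auto
  \<comment> \<open>For z >= c the cross term has coefficient c/z <= 1 and is at most half of the
    squares, so \<open>Q\<close> controls the energy \<open>q\<close>.\<close>
  have qQ: "q z \<le> 2 * Q z" if "c \<le> z" for z
  proof -
    define X where "X = c / z * J z * J' z"
    have "\<bar>c / z\<bar> * \<bar>2 * (J z * J' z)\<bar> \<le> 1 * ((J z)\<^sup>2 + (J' z)\<^sup>2)"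
      using that c JJ[of "J z" "J' z"] by (intro mult_mono) auto
    also have "\<bar>c / z\<bar> * \<bar>2 * (J z * J' z)\<bar> = \<bar>2 * X\<bar>"
      unfolding X_def by (simp add: abs_mult)
    finally have "0 \<le> (J z)\<^sup>2 + (J' z)\<^sup>2 + 2 * (c / z * J z * J' z)"
      unfolding X_def[symmetric] using abs_ge_minus_self[of "2 * X"] by simp
    then have "0 \<le> z powr c * ((J z)\<^sup>2 + (J' z)\<^sup>2 + 2 * (c / z * J z * J' z))"
      by (intro mult_nonneg_nonneg) auto
    then show ?thesis by (simp add: Q_def q_def algebra_simps)
  qed
  \<comment> \<open>Without the cross term the derivative would be c z^(c-1) (J^2 - J'^2), of
    relative order 1/z, which is not integrable. The cross term cancels it exactly and leaves
    relative order 1/z^2.\<close>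
  have dQ: "(Q has_real_derivative - c * z powr (c - 2) * (J z * J' z)) (at z)" if "0 < z" for z
  proof -
    define X D where "X = - c / z * J' z - J z"
      and "D = 2 * J z * J' z + 2 * J' z * X + (- c / z\<^sup>2 * J z * J' z + c / z * (J' z * J' z + J z * X))"
    define R where "R z = (J z)\<^sup>2 + (J' z)\<^sup>2 + c / z * J z * J' z" for z
    have "(R has_real_derivative D) (at z)"
      unfolding R_def D_def X_def using that
      by (auto intro!: derivative_eq_intros dJ dJ')
        (simp add: divide_simps power2_eq_square, simp add: algebra_simps)
    from DERIV_mult[OF has_real_derivative_powr[OF that] this]
    have "(Q has_real_derivative c * z powr (c - 1) * R z + D * z powr c) (at z)"
      unfolding Q_def[abs_def] R_def .
    also have "z powr (c - 1) = z powr (c - 2) * z"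
      using that by (simp add: powr_diff power2_eq_square)
    also have "z powr c = z powr (c - 2) * z\<^sup>2"
      using that by (simp add: powr_diff)
    also have "c * (z powr (c - 2) * z) * R z + D * (z powr (c - 2) * z\<^sup>2)
        = z powr (c - 2) * (c * z * R z + z\<^sup>2 * D)"
      by (simp add: algebra_simps)
    also have "c * z * R z + z\<^sup>2 * D = - c * (J z * J' z)"
      unfolding R_def D_def X_def using that
      by (simp add: divide_simps power2_eq_square) (simp add: algebra_simps)
    finally show ?thesis by (simp add: algebra_simps)
  qed
  \<comment> \<open>The integrating factor has logarithmic derivative -c/z^2, which outweighs the
    derivative of \<open>Q\<close>: for z >= c that is at most (c/z^2) Q in absolute value.\<close>
  define P where "P z = Q z * exp (c / z)" for z
  have P: "P z \<le> P c" if "c \<le> z" for z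
  proof (rule DERIV_nonpos_imp_nonincreasing[OF that])
    fix x assume x: "c \<le> x" "x \<le> z"
    then have x0: "0 < x" using c by simp
    have "(P has_real_derivative (- c * x powr (c - 2) * (J x * J' x) - c / x\<^sup>2 * Q x) * exp (c / x)) (at x)"
      unfolding P_def using x0
      by (auto intro!: derivative_eq_intros dQ simp: algebra_simps power2_eq_square)
    moreover have "- c * x powr (c - 2) * (J x * J' x) - c / x\<^sup>2 * Q x \<le> 0"
    proof -
      have e: "x powr (c - 2) = x powr c / x\<^sup>2"
        using x0 by (simp add: powr_diff)
      have "- (2 * (J x * J' x)) \<le> (J x)\<^sup>2 + (J' x)\<^sup>2"
        using JJ[of "J x" "J' x"] by linarith
      then have "x powr c * (- (2 * (J x * J' x))) \<le> q x"
        unfolding q_def by (intro mult_left_mono) auto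
      with qQ[OF x(1)] have "x powr c * - (J x * J' x) - Q x \<le> 0" by linarith
      then have "c / x\<^sup>2 * (x powr c * - (J x * J' x) - Q x) \<le> 0"
        using c by (intro mult_nonneg_nonpos) auto
      then show ?thesis by (simp add: e algebra_simps)
    qed
    ultimately show "\<exists>y. (P has_real_derivative y) (at x) \<and> y \<le> 0"
      by (intro exI conjI) (auto intro!: mult_nonpos_nonneg)
  qed
  \<comment> \<open>Up to c the bound |J| <= 1 suffices; beyond c, \<open>P\<close> is at most its
    value at c and \<open>exp (c / z)\<close> is at least 1.\<close>
  define K where "K = max (c powr c) (2 * P c)"
  have K0: "0 < K" using c by (simp add: K_def less_max_iff_disj)
  have K: "z powr c * (J z)\<^sup>2 \<le> K" if "0 < z" for z
  proof (cases "z \<le> c")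
    case True
    have "z powr c * (J z)\<^sup>2 \<le> c powr c * 1"
      using True that c J1[of z] by (intro mult_mono powr_mono2) (auto simp: abs_square_le_1)
    then show ?thesis by (simp add: K_def)
  next
    case False
    have q: "z powr c * (J z)\<^sup>2 \<le> q z"
      by (simp add: q_def algebra_simps)
    also have Q: "q z \<le> 2 * Q z" using qQ False by simp
    also have "2 * Q z \<le> 2 * P c"
    proof -
      have "0 \<le> z powr c * (J z)\<^sup>2" by simp
      then have "0 \<le> Q z" using q Q by linarith
      then have "Q z * 1 \<le> P z"
        unfolding P_def using c False by (intro mult_left_mono) auto
      then show ?thesis using P[of z] False by simp
    qed
    finally show ?thesis by (simp add: K_def)
  qed
  show ?thesis
  proof
    show "0 < sqrt K" using K0 by simp
    fix z :: real assume z: "0 < z"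
    have "(nbessel a (z\<^sup>2))\<^sup>2 \<le> K / z powr c"
      using K[OF z] z by (simp add: J_def field_simps)
    then have "\<bar>nbessel a (z\<^sup>2)\<bar> \<le> sqrt (K / z powr c)"
      using real_sqrt_le_mono by fastforce
    also have "\<dots> = sqrt K * z powr - (a - 1 / 2)"
    proof -
      have "sqrt (z powr c) = (z powr c) powr (1 / 2)"
        by (rule powr_half_sqrt[symmetric]) simp
      also have "\<dots> = z powr (a - 1 / 2)"
        unfolding powr_powr by (rule arg_cong[where f = "(powr) z"]) (simp add: c_def)
      finally show ?thesis
        by (simp only: real_sqrt_divide powr_minus divide_inverse[of "sqrt K"])
    qed
    finally show "\<bar>nbessel a (z\<^sup>2)\<bar> \<le> sqrt K * z powr - (a - 1 / 2)" .
  qed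
qed

section \<open>The frequency weight\<close>

definition weight :: "real \<Rightarrow> real" where
  "weight l = (if 0 < l then exp (- (l + 1 / l)) else 0)"

definition wmeasure :: "real measure" where
  "wmeasure = density lborel (\<lambda>l. ennreal (weight l))"

lemma weight_nonneg [simp]: "0 \<le> weight l"
  by (simp add: weight_def)

lemma borel_measurable_weight [measurable]: "weight \<in> borel_measurable borel"
  unfolding weight_def[abs_def] by measurable

lemma sets_wmeasure [simp, measurable_cong]: "sets wmeasure = sets borel"
  by (simp add: wmeasure_def)

lemma add_inverse_ge_1: "1 \<le> l + 1 / l" if "0 < l" for l :: real
proof (cases "1 \<le> l")
  case True
  then have "0 \<le> 1 / l" by simp
  with True show ?thesis by linarith
next
  case False
  then have "1 \<le> 1 / l" using that by simp
  then show ?thesis using that by linarith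
qed

lemma power_le_fact_exp: "x ^ n \<le> fact n * exp x" if "0 \<le> x" for x :: real
proof -
  have s: "(\<lambda>i. x ^ i /\<^sub>R fact i) sums exp x"
    by (rule exp_converges)
  have "(\<Sum>i\<in>{n}. x ^ i /\<^sub>R fact i) \<le> (\<Sum>i. x ^ i /\<^sub>R fact i)"
    by (rule sum_le_suminf[OF sums_summable[OF s]]) (use that in auto)
  then show ?thesis
    unfolding sums_unique[OF s, symmetric] by (simp add: field_simps)
qed

text \<open>For y = l + 1/l the bound y^(N+2) exp(-y) <= (N+2)! leaves two spare powers of 1/y.
  Since y^2 = l^2 + 2 + 1/l^2, they give integrability at infinity through 1/(1 + l^2) and vanishing
  at 0 through l^2.\<close>

lemma weight_bound:
  assumes "0 < l"
  shows "(l + 1 / l) ^ N * weight l \<le> fact (N + 2) * min (l\<^sup>2) (1 / (1 + l\<^sup>2))"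
proof -
  define y where "y = l + 1 / l"
  have y: "1 \<le> y" using add_inverse_ge_1[OF assms] by (simp add: y_def)
  have "y ^ (N + 2) * exp (- y) \<le> fact (N + 2) * exp y * exp (- y)"
    using power_le_fact_exp[of y "N + 2"] y by (intro mult_right_mono) auto
  then have "y ^ N * y\<^sup>2 * weight l \<le> fact (N + 2) * exp y * exp (- y)"
    unfolding power_add using assms by (simp add: weight_def y_def)
  also have "\<dots> = fact (N + 2)" by (simp add: exp_minus)
  finally have 1: "y ^ N * weight l \<le> fact (N + 2) / y\<^sup>2"
    using y by (simp add: field_simps)
  have sq: "y\<^sup>2 = l\<^sup>2 + 2 + 1 / l\<^sup>2"
    using assms by (simp add: y_def power2_sum power_divide)
  have "1 / y\<^sup>2 \<le> 1 / (1 + l\<^sup>2)"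
    using sq assms by (intro frac_le) (auto intro: add_pos_nonneg)
  moreover have "1 / y\<^sup>2 \<le> 1 / (1 / l\<^sup>2)"
    using sq assms by (intro frac_le) auto
  ultimately have "1 / y\<^sup>2 \<le> min (l\<^sup>2) (1 / (1 + l\<^sup>2))" by simp
  then have "fact (N + 2) * (1 / y\<^sup>2) \<le> fact (N + 2) * min (l\<^sup>2) (1 / (1 + l\<^sup>2))"
    by (intro mult_left_mono) auto
  with 1 show ?thesis by (simp add: y_def)
qed

lemma integrable_weighted:
  fixes f :: "real \<Rightarrow> 'b::{banach, second_countable_topology}"
  assumes [measurable]: "f \<in> borel_measurable borel"
    and "\<And>l. 0 < l \<Longrightarrow> norm (f l) \<le> C * (l + 1 / l) ^ N"
  shows "integrable lborel (\<lambda>l. weight l *\<^sub>R f l)"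
proof (rule Bochner_Integration.integrable_bound)
  let ?g = "\<lambda>l::real. 1 / (1 + l\<^sup>2) * indicator {0..} l"
  have "(\<integral>\<^sup>+l. ennreal (1 / (1 + l\<^sup>2)) * indicator {0..} l \<partial>lborel) = pi / 2 - arctan 0"
    by (rule nn_integral_FTC_atLeast)
      (auto intro!: derivative_eq_intros tendsto_arctan_at_top add_pos_nonneg simp: inverse_eq_divide)
  then have "(\<integral>\<^sup>+l. ennreal (?g l) \<partial>lborel) < \<infinity>"
    by (simp add: ennreal_mult' ennreal_indicator flip: times_divide_eq_left)
  then have "integrable lborel ?g"
    by (intro integrableI_nonneg) auto
  then show "integrable lborel (\<lambda>l. \<bar>C\<bar> * fact (N + 2) * ?g l)"
    by (rule integrable_mult_right)
  show "AE l in lborel. norm (weight l *\<^sub>R f l) \<le> norm (\<bar>C\<bar> * fact (N + 2) * ?g l)"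
  proof (intro AE_I2)
    fix l :: real
    show "norm (weight l *\<^sub>R f l) \<le> norm (\<bar>C\<bar> * fact (N + 2) * ?g l)"
    proof (cases "0 < l")
      case True
      have "norm (weight l *\<^sub>R f l) \<le> weight l * (\<bar>C\<bar> * (l + 1 / l) ^ N)"
        using assms(2)[OF True] add_inverse_ge_1[OF True]
        by (auto intro!: mult_left_mono order_trans[OF assms(2)[OF True]] mult_right_mono)
      also have "\<dots> = \<bar>C\<bar> * ((l + 1 / l) ^ N * weight l)" by simp
      also have "\<dots> \<le> \<bar>C\<bar> * (fact (N + 2) * (1 / (1 + l\<^sup>2)))"
        using weight_bound[OF True, of N]
        by (intro mult_left_mono order_trans[OF weight_bound[OF True]]) auto
      finally show ?thesis using True by (simp add: abs_mult add_pos_nonneg)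
    qed (simp add: weight_def)
  qed
qed (use assms(1) in measurable)

lemma wmeasure_integral_eq:
  fixes f :: "real \<Rightarrow> 'b::{banach, second_countable_topology}"
  assumes [measurable]: "f \<in> borel_measurable borel"
  shows "integral\<^sup>L wmeasure f = (\<integral>l. weight l *\<^sub>R f l \<partial>lborel)"
  unfolding wmeasure_def by (rule integral_density) auto

lemma integrable_wmeasure:
  fixes f :: "real \<Rightarrow> 'b::{banach, second_countable_topology}"
  assumes [measurable]: "f \<in> borel_measurable borel"
    and "\<And>l. 0 < l \<Longrightarrow> norm (f l) \<le> C * (l + 1 / l) ^ N"
  shows "integrable wmeasure f"
  using integrable_weighted[OF assms] unfolding wmeasure_def
  by (subst integrable_density) auto

lemma AE_wmeasure_pos: "AE l in wmeasure. 0 < l"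
  unfolding wmeasure_def by (subst AE_density) (auto simp: weight_def)

text \<open>These are the constants of the later estimates: since l + 1/l >= 1, a single power of it
  dominates both large and small frequencies.\<close>

definition moment :: "nat \<Rightarrow> real" where
  "moment N = (\<integral>l. (l + 1 / l) ^ N \<partial>wmeasure)"

lemma integrable_moment: "integrable wmeasure (\<lambda>l. (l + 1 / l) ^ N)"
  by (rule integrable_wmeasure[where C = 1 and N = N])
    (auto simp: norm_power abs_of_nonneg)

lemma moment_nonneg: "0 \<le> moment N"
  unfolding moment_def
  by (rule integral_nonneg_AE) (use AE_wmeasure_pos in \<open>auto elim!: eventually_mono\<close>)

lemma norm_wmeasure_integral_le:
  fixes f :: "real \<Rightarrow> 'b::{banach, second_countable_topology}"
  assumes "\<And>l. 0 < l \<Longrightarrow> norm (f l) \<le> C * (l + 1 / l) ^ N"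
  shows "norm (integral\<^sup>L wmeasure f) \<le> C * moment N"
proof (cases "integrable wmeasure f")
  case True
  have "norm (integral\<^sup>L wmeasure f) \<le> (\<integral>l. norm (f l) \<partial>wmeasure)"
    by simp
  also have "\<dots> \<le> (\<integral>l. C * (l + 1 / l) ^ N \<partial>wmeasure)"
    using True integrable_moment AE_wmeasure_pos assms
    by (intro integral_mono_AE) (auto elim!: eventually_mono)
  finally show ?thesis by (simp add: moment_def)
next
  case False
  \<comment> \<open>A non-integrable function has integral 0, so only the sign of \<open>C\<close>
    is at stake; at l = 1 the base l + 1/l equals 2.\<close>
  have "0 \<le> C * 2 ^ N" using assms[of 1] norm_ge_zero[of "f 1"] by (simp del: norm_ge_zero)
  then have "0 \<le> C" using mult_neg_pos[of C "2 ^ N"] by (cases "C < 0") auto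
  with False show ?thesis by (simp add: not_integrable_integral_eq moment_nonneg)
qed

text \<open>The factor \<open>1 - 1 / l\<^sup>2\<close> is minus the logarithmic derivative of the weight.\<close>

lemma wmeasure_integral_by_parts:
  fixes F F' :: "real \<Rightarrow> complex"
  assumes [measurable]: "F \<in> borel_measurable borel" "F' \<in> borel_measurable borel"
    and deriv: "\<And>l. 0 < l \<Longrightarrow> (F has_vector_derivative F' l) (at l)"
    and cont: "continuous_on {0<..} F'"
    and F: "\<And>l. 0 < l \<Longrightarrow> norm (F l) \<le> C * (l + 1 / l) ^ N"
    and F': "\<And>l. 0 < l \<Longrightarrow> norm (F' l) \<le> C' * (l + 1 / l) ^ N'"
  shows "integral\<^sup>L wmeasure F' = (\<integral>l. of_real (1 - 1 / l\<^sup>2) * F l \<partial>wmeasure)"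
proof -
  define g where "g l = exp (- (l + 1 / l))" for l :: real
  define h where "h l = g l *\<^sub>R (F' l - of_real (1 - 1 / l\<^sup>2) * F l)" for l
  have g: "weight l = g l" if "0 < l" for l
    using that by (simp add: weight_def g_def)
  have C: "0 \<le> C"
  proof -
    have "0 \<le> C * 2 ^ N" using F[of 1] norm_ge_zero[of "F 1"] by (simp del: norm_ge_zero)
    then show ?thesis using mult_neg_pos[of C "2 ^ N"] by (cases "C < 0") auto
  qed
  have hb: "norm (of_real (1 - 1 / l\<^sup>2) * F l) \<le> C * (l + 1 / l) ^ (N + 2)" if "0 < l" for l
  proof -
    have "\<bar>1 - 1 / l\<^sup>2\<bar> \<le> 1 + 1 / l\<^sup>2" using that by (auto simp: abs_le_iff)
    also have "\<dots> \<le> (l + 1 / l)\<^sup>2"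
      using that by (simp add: power2_sum power_divide)
    finally have "norm (of_real (1 - 1 / l\<^sup>2) * F l) \<le> (l + 1 / l)\<^sup>2 * (C * (l + 1 / l) ^ N)"
      unfolding norm_mult norm_of_real using F[OF that] by (intro mult_mono) auto
    then show ?thesis by (simp add: power_add power2_eq_square mult_ac)
  qed
  have int1: "integrable lborel (\<lambda>l. weight l *\<^sub>R F' l)"
    by (rule integrable_weighted[OF _ F']) auto
  have int2: "integrable lborel (\<lambda>l. weight l *\<^sub>R (of_real (1 - 1 / l\<^sup>2) * F l))"
    by (rule integrable_weighted[OF _ hb]) auto
  have h_eq: "indicator {0<..} l *\<^sub>R h l
      = weight l *\<^sub>R F' l - weight l *\<^sub>R (of_real (1 - 1 / l\<^sup>2) * F l)" for l
  proof (cases "0 < l")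
    case True
    then show ?thesis by (simp add: h_def g scaleR_diff_right)
  qed (simp add: weight_def)
  \<comment> \<open>One bound for both ends: the minimum tends to 0 at 0 through l^2 and at infinity
    through 1/(1 + l^2), so neither boundary term survives.\<close>
  have Flim: "norm (g l *\<^sub>R F l) \<le> C * (fact (N + 2) * min (l\<^sup>2) (1 / (1 + l\<^sup>2)))" if "0 < l" for l
  proof -
    have "norm (g l *\<^sub>R F l) \<le> g l * (C * (l + 1 / l) ^ N)"
      using F[OF that] by (simp add: g_def mult_left_mono)
    also have "\<dots> = C * ((l + 1 / l) ^ N * weight l)" using g[OF that] by simp
    also have "\<dots> \<le> C * (fact (N + 2) * min (l\<^sup>2) (1 / (1 + l\<^sup>2)))"
      by (intro mult_left_mono weight_bound that C)
    finally show ?thesis .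
  qed
  have "(LBINT l=ereal 0..\<infinity>. h l) = 0 - 0"
  proof (rule interval_integral_FTC_integrable)
    show "ereal 0 < \<infinity>" by simp
    show "((\<lambda>l. g l *\<^sub>R F l) has_vector_derivative h l) (at l)"
      if "ereal 0 < ereal l" "ereal l < \<infinity>" for l
    proof -
      have l: "0 < l" using that by simp
      have "(g has_real_derivative - g l * (1 - 1 / l\<^sup>2)) (at l)"
        unfolding g_def using l by (auto intro!: derivative_eq_intros simp: power2_eq_square algebra_simps)
      then have "((\<lambda>l. g l *\<^sub>R F l) has_vector_derivative g l *\<^sub>R F' l + (- g l * (1 - 1 / l\<^sup>2)) *\<^sub>R F l) (at l)"
        by (rule has_vector_derivative_scaleR[OF _ deriv[OF l]])
      then show ?thesis
        by (simp add: h_def scaleR_conv_of_real algebra_simps)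
    qed
    show "isCont h l" if "ereal 0 < ereal l" "ereal l < \<infinity>" for l
    proof -
      have "continuous_on {0<..} F"
        using deriv by (auto intro!: continuous_at_imp_continuous_on dest!: has_vector_derivative_continuous)
      then have "continuous_on {0<..} h"
        unfolding h_def g_def by (intro continuous_intros cont) auto
      then show "isCont h l"
        using that by (simp add: continuous_on_eq_continuous_at)
    qed
    have "integrable lborel (\<lambda>l. indicator {0<..} l *\<^sub>R h l)"
      unfolding h_eq by (intro Bochner_Integration.integrable_diff int1 int2)
    then show "set_integrable lborel (einterval (ereal 0) \<infinity>) h"
      by (simp add: set_integrable_def)
    have "((\<lambda>l. g l *\<^sub>R F l) \<longlongrightarrow> 0) (at_right 0)"
    proof (rule Lim_null_comparison)
      show "\<forall>\<^sub>F l in at_right 0. norm (g l *\<^sub>R F l) \<le> C * (fact (N + 2) * min (l\<^sup>2) (1 / (1 + l\<^sup>2)))"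
        using Flim by (auto simp: eventually_at_right_field intro!: exI[of _ 1])
      have "((\<lambda>l. C * (fact (N + 2) * min (l\<^sup>2) (1 / (1 + l\<^sup>2)))) \<longlongrightarrow> C * (fact (N + 2) * min (0\<^sup>2) (1 / (1 + 0\<^sup>2)))) (at_right (0::real))"
        by (intro tendsto_intros) auto
      then show "((\<lambda>l. C * (fact (N + 2) * min (l\<^sup>2) (1 / (1 + l\<^sup>2)))) \<longlongrightarrow> 0) (at_right (0::real))"
        by simp
    qed
    then show "(((\<lambda>l. g l *\<^sub>R F l) \<circ> real_of_ereal) \<longlongrightarrow> 0) (at_right (ereal 0))"
      by (simp only: ereal_tendsto_simps)
    have "((\<lambda>l. g l *\<^sub>R F l) \<longlongrightarrow> 0) at_top"
    proof (rule Lim_null_comparison)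
      show "\<forall>\<^sub>F l in at_top. norm (g l *\<^sub>R F l) \<le> C * fact (N + 2) * (1 / (1 + l\<^sup>2))"
        using eventually_gt_at_top[of 0]
      proof eventually_elim
        case (elim l)
        have "C * (fact (N + 2) * min (l\<^sup>2) (1 / (1 + l\<^sup>2))) \<le> C * (fact (N + 2) * (1 / (1 + l\<^sup>2)))"
          using C by (intro mult_left_mono) auto
        with Flim[OF elim] show ?case by simp
      qed
      show "((\<lambda>l. C * fact (N + 2) * (1 / (1 + l\<^sup>2))) \<longlongrightarrow> 0) at_top"
        by real_asymp
    qed
    then show "(((\<lambda>l. g l *\<^sub>R F l) \<circ> real_of_ereal) \<longlongrightarrow> 0) (at_left \<infinity>)"
      by (simp only: ereal_tendsto_simps)
  qed
  then have "(\<integral>l. indicator {0<..} l *\<^sub>R h l \<partial>lborel) = 0"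
    by (simp add: interval_integral_to_infinity_eq set_lebesgue_integral_def)
  then show ?thesis
    unfolding h_eq using int1 int2 by (simp add: wmeasure_integral_eq)
qed

section \<open>Radial waves\<close>

lemma borel_measurable_power_int [measurable]: "(\<lambda>l::real. l powi k) \<in> borel_measurable borel"
  unfolding power_int_def by measurable

lemma abs_power_int_le:
  fixes l :: real
  assumes "0 < l"
  shows "\<bar>l powi k\<bar> \<le> (l + 1 / l) ^ nat \<bar>k\<bar>"
proof (cases "0 \<le> k")
  case True
  then have "\<bar>l powi k\<bar> = l ^ nat \<bar>k\<bar>" using assms by (simp add: power_int_def)
  then show ?thesis using assms by (simp add: power_mono)
next
  case False
  then have "\<bar>l powi k\<bar> = (1 / l) ^ nat \<bar>k\<bar>"
    using assms by (simp add: power_int_def inverse_eq_divide power_abs)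
  also have "\<dots> \<le> (l + 1 / l) ^ nat \<bar>k\<bar>"
    using assms by (intro power_mono) auto
  finally show ?thesis .
qed

text \<open>For \<open>a = n / 2\<close> the function \<open>bwave a k (|x|\<^sup>2) t\<close> solves the wave equation in dimension
  \<open>n\<close>.  The argument \<open>s = |x|\<^sup>2\<close> is meant to be nonnegative; for negative \<open>s\<close> the integral may
  diverge.\<close>

definition bwave :: "real \<Rightarrow> int \<Rightarrow> real \<Rightarrow> real \<Rightarrow> complex" where
  "bwave a k s t = (\<integral>l. of_real (l powi k * nbessel a (l\<^sup>2 * s)) * cis (t * l) \<partial>wmeasure)"

lemma borel_measurable_cis_mult [measurable]: "(\<lambda>l. cis (t * l)) \<in> borel_measurable borel"
  by (intro borel_measurable_continuous_onI continuous_intros)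

lemma borel_measurable_nbessel_sq [measurable]:
  "1 \<le> a \<Longrightarrow> (\<lambda>l. nbessel a (l\<^sup>2 * s)) \<in> borel_measurable borel"
  by (rule measurable_compose[OF _ borel_measurable_nbessel]) auto

lemma borel_measurable_bwave_integrand [measurable]:
  assumes "1 \<le> a"
  shows "(\<lambda>l. complex_of_real (l powi k * nbessel a (l\<^sup>2 * s)) * cis (t * l)) \<in> borel_measurable borel"
proof -
  note [measurable] = borel_measurable_nbessel_sq[OF assms, of s]
  show ?thesis by measurable
qed

lemma bwave_integrand_bound:
  assumes "1 \<le> a" "0 \<le> s" "0 < l"
  shows "norm (of_real (l powi k * nbessel a (l\<^sup>2 * s)) * cis (t * l)) \<le> 1 * (l + 1 / l) ^ nat \<bar>k\<bar>"
proof -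
  have "\<bar>l powi k\<bar> * \<bar>nbessel a (l\<^sup>2 * s)\<bar> \<le> (l + 1 / l) ^ nat \<bar>k\<bar> * 1"
    using assms by (intro mult_mono abs_power_int_le abs_nbessel_le_1) auto
  then show ?thesis
    by (simp only: norm_mult norm_of_real norm_cis abs_mult mult_1 mult_1_right)
qed

lemma integrable_bwave:
  assumes "1 \<le> a" "0 \<le> s"
  shows "integrable wmeasure (\<lambda>l. of_real (l powi k * nbessel a (l\<^sup>2 * s)) * cis (t * l))"
  by (intro integrable_wmeasure[OF _ bwave_integrand_bound] borel_measurable_bwave_integrand assms)

lemma norm_bwave_le:
  assumes "1 \<le> a" "0 \<le> s"
  shows "norm (bwave a k s t) \<le> moment (nat \<bar>k\<bar>)"
  using norm_wmeasure_integral_le[OF bwave_integrand_bound[OF assms]] by (simp add: bwave_def)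

text \<open>The factor l^2 s of the pointwise recurrence splits: s leaves the integral and l^2
  raises the exponent from k to k + 2.\<close>

lemma bwave_rec:
  assumes "1 \<le> a" "0 \<le> s"
  shows "of_real s * bwave (a + 2) (k + 2) s t
       = of_real (4 * a * (a + 1)) * (bwave (a + 1) k s t - bwave a k s t)"
proof -
  have [simp]: "1 \<le> a + 1" "1 \<le> a + 2" using assms by auto
  have m: "(\<lambda>l. of_real (l powi k * nbessel b (l\<^sup>2 * s)) * cis (t * l)) \<in> borel_measurable wmeasure"
    if "1 \<le> b" for b k
    using borel_measurable_bwave_integrand[OF that] by (simp cong: measurable_cong_sets)
  have "of_real s * bwave (a + 2) (k + 2) s t
      = (\<integral>l. of_real s * (of_real (l powi (k + 2) * nbessel (a + 2) (l\<^sup>2 * s)) * cis (t * l)) \<partial>wmeasure)"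
    unfolding bwave_def by simp
  also have "\<dots> = (\<integral>l. of_real (4 * a * (a + 1)) *
      (of_real (l powi k * nbessel (a + 1) (l\<^sup>2 * s)) * cis (t * l)
       - of_real (l powi k * nbessel a (l\<^sup>2 * s)) * cis (t * l)) \<partial>wmeasure)"
  proof (rule integral_cong_AE)
    show "AE l in wmeasure. of_real s * (of_real (l powi (k + 2) * nbessel (a + 2) (l\<^sup>2 * s)) * cis (t * l))
      = of_real (4 * a * (a + 1)) * (of_real (l powi k * nbessel (a + 1) (l\<^sup>2 * s)) * cis (t * l)
       - of_real (l powi k * nbessel a (l\<^sup>2 * s)) * cis (t * l))"
      using AE_wmeasure_pos
    proof eventually_elim
      case (elim l)
      have "s * (l powi (k + 2) * nbessel (a + 2) (l\<^sup>2 * s)) = l powi k * (l\<^sup>2 * s * nbessel (a + 2) (l\<^sup>2 * s))"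
        using elim by (simp add: power_int_add)
      also have "\<dots> = 4 * a * (a + 1) * (l powi k * nbessel (a + 1) (l\<^sup>2 * s) - l powi k * nbessel a (l\<^sup>2 * s))"
        unfolding nbessel_rec[OF assms(1)] by (simp add: algebra_simps)
      finally show ?case
        by (simp only: of_real_mult[symmetric] of_real_diff[symmetric] mult.assoc[symmetric] left_diff_distrib[symmetric])
    qed
  qed (intro borel_measurable_times borel_measurable_diff borel_measurable_const m; use assms in simp)+
  also have "\<dots> = of_real (4 * a * (a + 1)) * (bwave (a + 1) k s t - bwave a k s t)"
    unfolding bwave_def integral_mult_right_zero
    by (subst Bochner_Integration.integral_diff) (use assms in \<open>auto intro!: integrable_bwave simp del: of_real_mult\<close>)
  finally show ?thesis .
qed

text \<open>The factor \<i> t comes from the phase. The weight contributes the first two terms on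
  the right, the power of \<open>l\<close> the third, and the Bessel factor, by its derivative rule,
  the last: decay in t is paid for with s and a higher parameter.\<close>

lemma bwave_by_parts:
  assumes a: "1 \<le> a" and s: "0 \<le> s"
  shows "\<i> * of_real t * bwave a k s t
       = bwave a k s t - bwave a (k - 2) s t - of_int k * bwave a (k - 1) s t
         + of_real (s / (2 * a)) * bwave (a + 1) (k + 1) s t"
proof -
  let ?I = "\<lambda>a k l. of_real (l powi k * nbessel a (l\<^sup>2 * s)) * cis (t * l)"
  let ?F = "?I a k"
  let ?F' = "\<lambda>l. of_int k * ?I a (k - 1) l - of_real (s / (2 * a)) * ?I (a + 1) (k + 1) l + \<i> * of_real t * ?I a k l"
  have a1: "1 \<le> a + 1" using a by simp
  note [measurable] = borel_measurable_nbessel_sq[OF a, of s] borel_measurable_nbessel_sq[OF a1, of s]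
  note int = integrable_bwave[OF a s] integrable_bwave[OF a1 s]
  have "integral\<^sup>L wmeasure ?F' = (\<integral>l. of_real (1 - 1 / l\<^sup>2) * ?F l \<partial>wmeasure)"
  proof (rule wmeasure_integral_by_parts)
    show "?F \<in> borel_measurable borel" "?F' \<in> borel_measurable borel"
      by measurable
    show "(?F has_vector_derivative ?F' l) (at l)" if l: "0 < l" for l
    proof -
      have "((\<lambda>l. l powi k * nbessel a (l\<^sup>2 * s)) has_real_derivative
          of_int k * l powi (k - 1) * nbessel a (l\<^sup>2 * s)
          - s / (2 * a) * (l powi (k + 1) * nbessel (a + 1) (l\<^sup>2 * s))) (at l)"
        using l a by (auto intro!: derivative_eq_intros simp: power_int_add field_simps)
      then have 1: "((\<lambda>l. of_real (l powi k * nbessel a (l\<^sup>2 * s)) :: complex) has_vector_derivative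
          of_real (of_int k * l powi (k - 1) * nbessel a (l\<^sup>2 * s)
          - s / (2 * a) * (l powi (k + 1) * nbessel (a + 1) (l\<^sup>2 * s)))) (at l)"
        by (intro has_vector_derivative_of_real) (simp add: has_real_derivative_iff_has_vector_derivative)
      have 2: "((\<lambda>l. cis (t * l)) has_vector_derivative \<i> * of_real t * cis (t * l)) (at l)"
        unfolding has_vector_derivative_def
        by (auto intro!: derivative_eq_intros simp: scaleR_conv_of_real algebra_simps)
      show ?thesis
        using has_vector_derivative_mult[OF 1 2]
        by (rule has_vector_derivative_eq_rhs) (simp add: algebra_simps)
    qed
    have c: "continuous_on {0<..} (\<lambda>l. nbessel b (l\<^sup>2 * s))" if "1 \<le> b" for b
      by (rule continuous_on_compose2[OF continuous_on_nbessel[OF that, of UNIV]]) (auto intro!: continuous_intros)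
    show "continuous_on {0<..} ?F'"
      by (intro continuous_intros c a a1) auto
    show "norm (?F l) \<le> 1 * (l + 1 / l) ^ nat \<bar>k\<bar>" if "0 < l" for l
      by (rule bwave_integrand_bound[OF a s that])
    let ?N = "nat \<bar>k\<bar> + 1"
    have mono: "norm (?I b m l) \<le> (l + 1 / l) ^ ?N" if "0 < l" "nat \<bar>m\<bar> \<le> ?N" "1 \<le> b" for l b m
      using bwave_integrand_bound[OF that(3) s that(1), of m t]
        power_increasing[OF that(2) add_inverse_ge_1[OF that(1)]] by linarith
    show "norm (?F' l) \<le> (\<bar>of_int k\<bar> + \<bar>s / (2 * a)\<bar> + \<bar>t\<bar>) * (l + 1 / l) ^ ?N" if "0 < l" for l
    proof -
      have "norm (?F' l) \<le> norm (of_int k * ?I a (k - 1) l)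
          + norm (of_real (s / (2 * a)) * ?I (a + 1) (k + 1) l) + norm (\<i> * of_real t * ?I a k l)"
        by (intro order_trans[OF norm_triangle_ineq] order_trans[OF norm_triangle_ineq4] add_mono order_refl)
      also have "\<dots> \<le> \<bar>of_int k\<bar> * (l + 1 / l) ^ ?N + \<bar>s / (2 * a)\<bar> * (l + 1 / l) ^ ?N + \<bar>t\<bar> * (l + 1 / l) ^ ?N"
        unfolding norm_mult[of _ "?I _ _ l"]
        by (intro add_mono mult_mono mono that a a1) (auto simp: norm_mult norm_divide)
      finally show ?thesis by (simp add: algebra_simps)
    qed
  qed
  also have "(\<integral>l. of_real (1 - 1 / l\<^sup>2) * ?F l \<partial>wmeasure) = (\<integral>l. ?I a k l - ?I a (k - 2) l \<partial>wmeasure)"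
  proof (rule integral_cong_AE)
    show "AE l in wmeasure. of_real (1 - 1 / l\<^sup>2) * ?F l = ?I a k l - ?I a (k - 2) l"
      using AE_wmeasure_pos
    proof eventually_elim
      case (elim l)
      then have "l powi (k - 2) = l powi k / l\<^sup>2" by (simp add: power_int_diff)
      then show ?case by (simp add: algebra_simps)
    qed
  qed measurable
  also have "\<dots> = bwave a k s t - bwave a (k - 2) s t"
    unfolding bwave_def by (rule Bochner_Integration.integral_diff) (rule int)+
  also have "integral\<^sup>L wmeasure ?F' = of_int k * bwave a (k - 1) s t
      - of_real (s / (2 * a)) * bwave (a + 1) (k + 1) s t + \<i> * of_real t * bwave a k s t"
    unfolding bwave_def
    by (subst Bochner_Integration.integral_add Bochner_Integration.integral_diff integral_mult_right_zero;
        (intro Bochner_Integration.integrable_diff integrable_mult_right int)?)+ rule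
  finally show ?thesis by (simp add: algebra_simps)
qed

text \<open>Integration by parts at (a + 1, k + 1), with s times the wave of parameter a + 2
  rewritten by the recurrence. This raises the parameter without any factor s.\<close>

lemma bwave_by_parts':
  assumes a: "1 \<le> a" and s: "0 \<le> s"
  shows "of_real (2 * a) * bwave a k s t
       = bwave (a + 1) (k + 1) s t - bwave (a + 1) (k - 1) s t
         - of_real (of_int k + 1 - 2 * a) * bwave (a + 1) k s t
         - \<i> * of_real t * bwave (a + 1) (k + 1) s t"
proof -
  have "of_real (s / (2 * (a + 1))) * bwave (a + 2) (k + 2) s t
      = of_real (1 / (2 * (a + 1))) * (of_real s * bwave (a + 2) (k + 2) s t)"
    by simp
  also have "\<dots> = of_real (1 / (2 * (a + 1)) * (4 * a * (a + 1))) * (bwave (a + 1) k s t - bwave a k s t)"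
    unfolding bwave_rec[OF assms] by (simp only: of_real_mult mult.assoc)
  also have "1 / (2 * (a + 1)) * (4 * a * (a + 1)) = 2 * a"
    using a by (simp add: field_simps)
  finally have e: "of_real (s / (2 * (a + 1))) * bwave (a + 2) (k + 2) s t
      = of_real (2 * a) * (bwave (a + 1) k s t - bwave a k s t)" .
  have "\<i> * of_real t * bwave (a + 1) (k + 1) s t
      = bwave (a + 1) (k + 1) s t - bwave (a + 1) (k - 1) s t - of_int (k + 1) * bwave (a + 1) k s t
        + of_real (s / (2 * (a + 1))) * bwave (a + 2) (k + 2) s t"
    using bwave_by_parts[of "a + 1" s t "k + 1"] a s by (simp add: add.assoc)
  then show ?thesis
    unfolding e by (simp add: algebra_simps)
qed

text \<open>Solved for its last term, \<open>bwave_by_parts\<close> absorbs a factor s and lowers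
  the parameter, at the price of a factor t, which is fixed here. Since the parameter may not drop
  below 1, \<open>bwave_by_parts'\<close> first lifts it from a to a + 1. The constant may depend on
  t.\<close>

lemma bwave_rapid_decay:
  assumes "1 \<le> a"
  shows "\<exists>C. \<forall>s\<ge>0. norm (of_real (s ^ m) * bwave a k s t) \<le> C"
  using assms
proof (induction m arbitrary: a k)
  case 0
  then show ?case using norm_bwave_le[OF 0] by auto
next
  case (Suc m)
  have lin: "\<exists>C. \<forall>s\<ge>0. norm (x * f s + y * g s) \<le> C"
    if "\<exists>C. \<forall>s\<ge>0. norm (f s) \<le> C" "\<exists>C. \<forall>s\<ge>0. norm (g s) \<le> C" for x y :: complex and f g :: "real \<Rightarrow> complex"
  proof -
    from that obtain C D where "\<forall>s\<ge>0. norm (f s) \<le> C" "\<forall>s\<ge>0. norm (g s) \<le> D" by blast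
    then have "norm (x * f s + y * g s) \<le> norm x * C + norm y * D" if "0 \<le> s" for s
      using that by (intro order_trans[OF norm_triangle_ineq] add_mono) (auto simp: norm_mult intro!: mult_left_mono)
    then show ?thesis by blast
  qed
  have up: "\<exists>C. \<forall>s\<ge>0. norm (of_real (s ^ Suc m) * bwave (b + 1) k s t) \<le> C" if b: "1 \<le> b" for b k
  proof -
    let ?h = "\<lambda>j s. of_real (s ^ m) * bwave b j s t"
    \<comment> \<open>The zero summand pads the expression to the nested two-term form that
      \<open>lin\<close> handles.\<close>
    have "of_real (s ^ Suc m) * bwave (b + 1) k s t
        = of_real (2 * b) * (1 * ((\<i> * of_real t - 1) * ?h (k - 1) s + 1 * ?h (k - 3) s)
          + of_int (k - 1) * ?h (k - 2) s) + 0 * ?h 0 s" if "0 \<le> s" for s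
    proof -
      have "of_real (s / (2 * b)) * bwave (b + 1) k s t
        = (\<i> * of_real t - 1) * bwave b (k - 1) s t + bwave b (k - 3) s t + of_int (k - 1) * bwave b (k - 2) s t"
        using bwave_by_parts[OF b that, of t "k - 1"] by (simp add: algebra_simps)
      then have "of_real (2 * b) * of_real (s ^ m) * (of_real (s / (2 * b)) * bwave (b + 1) k s t)
        = of_real (2 * b) * of_real (s ^ m) * ((\<i> * of_real t - 1) * bwave b (k - 1) s t + bwave b (k - 3) s t + of_int (k - 1) * bwave b (k - 2) s t)"
        by simp
      moreover have "of_real (2 * b) * of_real (s ^ m) * (of_real (s / (2 * b)) * bwave (b + 1) k s t)
          = of_real (s ^ Suc m) * bwave (b + 1) k s t"
        using b by simp
      ultimately show ?thesis by (simp add: algebra_simps)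
    qed
    then show ?thesis
      using lin[OF lin[OF lin[OF Suc.IH[OF b] Suc.IH[OF b]] Suc.IH[OF b]] Suc.IH[OF b],
          of "of_real (2 * b)" 1 "\<i> * of_real t - 1" "k - 1" 1 "k - 3" "of_int (k - 1)" "k - 2" 0 0]
      by simp
  qed
  let ?h = "\<lambda>j s. of_real (s ^ Suc m) * bwave (a + 1) j s t"
  have "of_real (s ^ Suc m) * bwave a k s t
      = of_real (1 / (2 * a)) * (1 * ((1 - \<i> * of_real t) * ?h (k + 1) s + (- 1) * ?h (k - 1) s)
          + (- of_real (of_int k + 1 - 2 * a)) * ?h k s) + 0 * ?h 0 s" if "0 \<le> s" for s
  proof -
    define K S where "K = complex_of_real (1 / (2 * a))" and "S = complex_of_real (s ^ Suc m)"
    have "K * of_real (2 * a) = 1" using Suc.prems by (simp add: K_def)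
    then have "S * bwave a k s t = K * of_real (2 * a) * (S * bwave a k s t)"
      by (simp only: mult_1)
    also have "\<dots> = K * S * (of_real (2 * a) * bwave a k s t)"
      by (simp only: mult_ac)
    finally show ?thesis
      unfolding bwave_by_parts'[OF Suc.prems that] S_def[symmetric] K_def[symmetric]
      by (simp add: algebra_simps)
  qed
  then show ?case
    using lin[OF lin[OF lin[OF up[OF Suc.prems] up[OF Suc.prems]] up[OF Suc.prems]] up[OF Suc.prems],
        of "of_real (1 / (2 * a))" 1 "1 - \<i> * of_real t" "k + 1" "- 1" "k - 1" "- of_real (of_int k + 1 - 2 * a)" k 0 0]
    by simp
qed

section \<open>Differentiation and Schwartz decay\<close>

lemma vector_derivative_bound:
  fixes f f' :: "real \<Rightarrow> 'b::real_normed_vector"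
  assumes "convex S" "\<And>z. z \<in> S \<Longrightarrow> (f has_vector_derivative f' z) (at z within S)"
    and "\<And>z. z \<in> S \<Longrightarrow> norm (f' z) \<le> B" "x \<in> S" "y \<in> S"
  shows "norm (f y - f x) \<le> B * \<bar>y - x\<bar>"
proof -
  have "norm (f y - f x) \<le> B * norm (y - x)"
  proof (rule differentiable_bound[OF assms(1)])
    show "(f has_derivative (\<lambda>h. h *\<^sub>R f' z)) (at z within S)" if "z \<in> S" for z
      using assms(2)[OF that] by (simp add: has_vector_derivative_def)
    show "onorm (\<lambda>h. h *\<^sub>R f' z) \<le> B" if "z \<in> S" for z
    proof (rule onorm_bound)
      show "0 \<le> B" using assms(3)[OF that] norm_ge_zero order_trans by blast
      show "norm (h *\<^sub>R f' z) \<le> B * norm h" for h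
        using mult_left_mono[OF assms(3)[OF that], of "\<bar>h\<bar>"] by (simp add: mult.commute)
    qed
  qed (use assms in auto)
  then show ?thesis by simp
qed

text \<open>The mean value inequality for \<open>f z - z *\<^sub>R f' x\<close>, whose derivative is
  bounded by B |y - x| through a first application to \<open>f'\<close>. This gives the constant B
  in place of the sharp B/2.\<close>

lemma vector_derivative_linearization_bound:
  fixes f f' f'' :: "real \<Rightarrow> 'b::real_normed_vector"
  assumes S: "convex S" "x \<in> S" "y \<in> S"
    and f: "\<And>z. z \<in> S \<Longrightarrow> (f has_vector_derivative f' z) (at z within S)"
    and f': "\<And>z. z \<in> S \<Longrightarrow> (f' has_vector_derivative f'' z) (at z within S)"
    and B: "\<And>z. z \<in> S \<Longrightarrow> norm (f'' z) \<le> B"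
  shows "norm (f y - f x - (y - x) *\<^sub>R f' x) \<le> B * (y - x)\<^sup>2"
proof -
  let ?T = "closed_segment x y"
  have T: "?T \<subseteq> S" using S by (simp add: closed_segment_subset)
  have B0: "0 \<le> B" using B[OF S(2)] norm_ge_zero order_trans by blast
  have "norm ((f y - y *\<^sub>R f' x) - (f x - x *\<^sub>R f' x)) \<le> (B * \<bar>y - x\<bar>) * \<bar>y - x\<bar>"
  proof (rule vector_derivative_bound[of ?T])
    fix z assume z: "z \<in> ?T"
    then have zS: "z \<in> S" using T by blast
    show "((\<lambda>z. f z - z *\<^sub>R f' x) has_vector_derivative f' z - f' x) (at z within ?T)"
      by (rule has_vector_derivative_within_subset[OF _ T])
        (auto intro!: derivative_eq_intros f zS)
    have "norm (f' z - f' x) \<le> B * \<bar>z - x\<bar>"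
      by (rule vector_derivative_bound[OF S(1) f' B S(2) zS])
    also have "\<dots> \<le> B * \<bar>y - x\<bar>"
      using z B0 by (intro mult_left_mono) (auto simp: closed_segment_eq_real_ivl split: if_splits)
    finally show "norm (f' z - f' x) \<le> B * \<bar>y - x\<bar>" .
  qed auto
  then show ?thesis
    by (simp add: algebra_simps power2_eq_square flip: abs_mult)
qed

text \<open>On the half-line \<open>nbessel\<close> is bounded by 1 for every parameter in use, and
  the second derivative is \<open>nbessel (a + 2)\<close> times a factor below 1.\<close>

lemma abs_nbessel_linearization:
  assumes a: "1 \<le> a" and "0 \<le> x" "0 \<le> y"
  shows "\<bar>nbessel a y - nbessel a x - (y - x) * (- 1 / (4 * a) * nbessel (a + 1) x)\<bar> \<le> (y - x)\<^sup>2"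
    and "\<bar>(- 1 / (4 * a) * nbessel (a + 1) x)\<bar> \<le> 1"
proof -
  have dj: "(nbessel b has_vector_derivative - 1 / (4 * b) * nbessel (b + 1) z) (at z within {0..})" if "1 \<le> b" for b z
    using has_field_derivative_at_within[OF nbessel_has_field_derivative[OF that]]
    by (simp add: has_real_derivative_iff_has_vector_derivative)
  have d2: "((\<lambda>z. - 1 / (4 * a) * nbessel (a + 1) z) has_vector_derivative
      - 1 / (4 * a) * (- 1 / (4 * (a + 1)) * nbessel (a + 1 + 1) z)) (at z within {0..})" for z
    by (rule has_vector_derivative_mult_right[OF dj]) (use a in simp)
  have small: "\<bar>- 1 / (4 * b) * v\<bar> \<le> 1" if "1 \<le> b" "\<bar>v\<bar> \<le> 1" for b v :: real
  proof -
    have "\<bar>- 1 / (4 * b)\<bar> \<le> 1" using that(1) by simp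
    then have "\<bar>- 1 / (4 * b)\<bar> * \<bar>v\<bar> \<le> 1 * 1" using that(2) by (intro mult_mono) auto
    then show ?thesis by (simp add: abs_mult)
  qed
  have b: "norm (- 1 / (4 * a) * (- 1 / (4 * (a + 1)) * nbessel (a + 1 + 1) z)) \<le> 1" if "0 \<le> z" for z
    unfolding real_norm_def using a that by (intro small abs_nbessel_le_1) auto
  have "norm (nbessel a y - nbessel a x - (y - x) *\<^sub>R (- 1 / (4 * a) * nbessel (a + 1) x)) \<le> 1 * (y - x)\<^sup>2"
    by (rule vector_derivative_linearization_bound[of "{0..}", OF _ _ _ dj d2 b]) (use assms in auto)
  then show "\<bar>nbessel a y - nbessel a x - (y - x) * (- 1 / (4 * a) * nbessel (a + 1) x)\<bar> \<le> (y - x)\<^sup>2"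
    by simp
  show "\<bar>(- 1 / (4 * a) * nbessel (a + 1) x)\<bar> \<le> 1"
    using assms by (intro small abs_nbessel_le_1) auto
qed

lemma norm_cis_linearization:
  "norm (cis v - cis u - of_real (v - u) * (\<i> * cis u)) \<le> (v - u)\<^sup>2"
  "norm (cis v - cis u) \<le> \<bar>v - u\<bar>"
proof -
  have d: "(cis has_vector_derivative \<i> * cis z) (at z within UNIV)" for z
    unfolding has_vector_derivative_def by (auto intro!: derivative_eq_intros)
  have "norm (cis v - cis u - (v - u) *\<^sub>R (\<i> * cis u)) \<le> 1 * (v - u)\<^sup>2"
    by (rule vector_derivative_linearization_bound[of UNIV, OF _ _ _ d has_vector_derivative_mult_right[OF d]])
      (auto simp: norm_mult)
  then show "norm (cis v - cis u - of_real (v - u) * (\<i> * cis u)) \<le> (v - u)\<^sup>2"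
    by (simp add: scaleR_conv_of_real)
  have "norm (cis v - cis u) \<le> 1 * \<bar>v - u\<bar>"
    by (rule vector_derivative_bound[of UNIV, OF _ d]) (auto simp: norm_mult)
  then show "norm (cis v - cis u) \<le> \<bar>v - u\<bar>" by simp
qed

lemma has_derivative_quadratic:
  assumes "bounded_linear D" and "\<And>y. y \<in> S \<Longrightarrow> norm (f y - f x - D (y - x)) \<le> C * (norm (y - x))\<^sup>2"
  shows "(f has_derivative D) (at x within S)"
proof (rule has_derivativeI_sandwich[of 1])
  show "norm (f y - f x - D (y - x)) / norm (y - x) \<le> C * norm (y - x)" if "y \<in> S" "y \<noteq> x" for y
    using assms(2)[OF that(1)] that(2) by (simp add: pos_divide_le_eq power2_eq_square mult.assoc)
  show "((\<lambda>y. C * norm (y - x)) \<longlongrightarrow> 0) (at x within S)"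
    by (rule tendsto_eq_intros tendsto_norm | simp)+
qed (use assms in auto)

text \<open>The product rule with an explicit quadratic remainder: the difference is (j' - j - d) c'
  + d (c' - c) + j (c' - c - e).\<close>

lemma norm_product_linearization:
  fixes j j' d :: real and c c' e :: complex
  assumes "\<bar>j\<bar> \<le> 1" "\<bar>j' - j - d\<bar> \<le> x\<^sup>2" "\<bar>d\<bar> \<le> \<bar>x\<bar>"
    and "norm c' = 1" "norm (c' - c - e) \<le> y\<^sup>2" "norm (c' - c) \<le> \<bar>y\<bar>"
  shows "norm (of_real j' * c' - of_real j * c - of_real d * c - of_real j * e) \<le> 2 * (x\<^sup>2 + y\<^sup>2)"
proof -
  have "of_real j' * c' - of_real j * c - of_real d * c - of_real j * e
      = of_real (j' - j - d) * c' + of_real d * (c' - c) + of_real j * (c' - c - e)"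
    by (simp add: algebra_simps)
  also have "norm \<dots> \<le> \<bar>j' - j - d\<bar> * norm c' + \<bar>d\<bar> * norm (c' - c) + \<bar>j\<bar> * norm (c' - c - e)"
    by (intro order_trans[OF norm_triangle_ineq] add_mono) (simp_all only: norm_mult norm_of_real order_refl)
  also have "\<dots> \<le> x\<^sup>2 * 1 + \<bar>x\<bar> * \<bar>y\<bar> + 1 * y\<^sup>2"
    using assms by (intro add_mono mult_mono) auto
  also have "\<bar>x\<bar> * \<bar>y\<bar> \<le> (x\<^sup>2 + y\<^sup>2) / 2"
    using sum_squares_bound[of "\<bar>x\<bar>" "\<bar>y\<bar>"] by simp
  also have "x\<^sup>2 * 1 + (x\<^sup>2 + y\<^sup>2) / 2 + 1 * y\<^sup>2 \<le> 2 * (x\<^sup>2 + y\<^sup>2)"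
    by simp
  finally show ?thesis by simp
qed

text \<open>Differentiation under the integral sign by Taylor's formula: the pointwise remainder in
  l^2 s and l t grows at most like the fourth power of l + 1/l, apart from \<open>l powi k\<close>,
  and therefore integrates to a moment.\<close>

lemma bwave_linearization:
  assumes a: "1 \<le> a" and s: "0 \<le> s" "0 \<le> s'"
  shows "norm (bwave a k s' t' - bwave a k s t
      - (of_real (s' - s) * (of_real (- 1 / (4 * a)) * bwave (a + 1) (k + 2) s t)
         + of_real (t' - t) * (\<i> * bwave a (k + 1) s t)))
    \<le> 2 * ((s' - s)\<^sup>2 + (t' - t)\<^sup>2) * moment (nat \<bar>k\<bar> + 4)"
proof -
  let ?I = "\<lambda>a k s t l. of_real (l powi k * nbessel a (l\<^sup>2 * s)) * cis (t * l)"
  let ?G = "\<lambda>l. ?I a k s' t' l - ?I a k s t l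
      - (of_real (s' - s) * (of_real (- 1 / (4 * a)) * ?I (a + 1) (k + 2) s t l)
         + of_real (t' - t) * (\<i> * ?I a (k + 1) s t l))"
  have a1: "1 \<le> a + 1" using a by simp
  note int = integrable_bwave[OF a s(1)] integrable_bwave[OF a s(2)] integrable_bwave[OF a1 s(1)]
  have "bwave a k s' t' - bwave a k s t
      - (of_real (s' - s) * (of_real (- 1 / (4 * a)) * bwave (a + 1) (k + 2) s t)
         + of_real (t' - t) * (\<i> * bwave a (k + 1) s t)) = integral\<^sup>L wmeasure ?G"
    unfolding bwave_def
    by (subst Bochner_Integration.integral_add Bochner_Integration.integral_diff integral_mult_right_zero;
        (intro Bochner_Integration.integrable_diff Bochner_Integration.integrable_add integrable_mult_right int)?)+ rule
  also have "norm \<dots> \<le> 2 * ((s' - s)\<^sup>2 + (t' - t)\<^sup>2) * moment (nat \<bar>k\<bar> + 4)"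
  proof (rule norm_wmeasure_integral_le)
    fix l :: real assume l: "0 < l"
    let ?y = "l + 1 / l"
    have G: "?G l = of_real (l powi k) * (of_real (nbessel a (l\<^sup>2 * s')) * cis (t' * l)
        - of_real (nbessel a (l\<^sup>2 * s)) * cis (t * l)
        - of_real ((l\<^sup>2 * s' - l\<^sup>2 * s) * (- 1 / (4 * a) * nbessel (a + 1) (l\<^sup>2 * s))) * cis (t * l)
        - of_real (nbessel a (l\<^sup>2 * s)) * (of_real (t' * l - t * l) * (\<i> * cis (t * l))))"
      using l by (simp add: power_int_add algebra_simps)
    have "norm (of_real (nbessel a (l\<^sup>2 * s')) * cis (t' * l)
        - of_real (nbessel a (l\<^sup>2 * s)) * cis (t * l)
        - of_real ((l\<^sup>2 * s' - l\<^sup>2 * s) * (- 1 / (4 * a) * nbessel (a + 1) (l\<^sup>2 * s))) * cis (t * l)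
        - of_real (nbessel a (l\<^sup>2 * s)) * (of_real (t' * l - t * l) * (\<i> * cis (t * l))))
        \<le> 2 * ((l\<^sup>2 * s' - l\<^sup>2 * s)\<^sup>2 + (t' * l - t * l)\<^sup>2)"
    proof (rule norm_product_linearization)
      have "\<bar>l\<^sup>2 * s' - l\<^sup>2 * s\<bar> * \<bar>- 1 / (4 * a) * nbessel (a + 1) (l\<^sup>2 * s)\<bar> \<le> \<bar>l\<^sup>2 * s' - l\<^sup>2 * s\<bar> * 1"
        using a s by (intro mult_left_mono abs_nbessel_linearization) auto
      then show "\<bar>(l\<^sup>2 * s' - l\<^sup>2 * s) * (- 1 / (4 * a) * nbessel (a + 1) (l\<^sup>2 * s))\<bar> \<le> \<bar>l\<^sup>2 * s' - l\<^sup>2 * s\<bar>"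
        by (simp only: abs_mult mult_1_right)
      show "\<bar>nbessel a (l\<^sup>2 * s') - nbessel a (l\<^sup>2 * s) - (l\<^sup>2 * s' - l\<^sup>2 * s) * (- 1 / (4 * a) * nbessel (a + 1) (l\<^sup>2 * s))\<bar>
          \<le> (l\<^sup>2 * s' - l\<^sup>2 * s)\<^sup>2"
        by (rule abs_nbessel_linearization(1)) (use a s in auto)
    qed (use a s in \<open>auto intro!: abs_nbessel_le_1 abs_nbessel_linearization norm_cis_linearization simp del: of_real_diff\<close>)
    also have "(l\<^sup>2 * s' - l\<^sup>2 * s)\<^sup>2 + (t' * l - t * l)\<^sup>2 = l ^ 4 * (s' - s)\<^sup>2 + l\<^sup>2 * (t' - t)\<^sup>2"
      by (simp add: power2_eq_square power4_eq_xxxx algebra_simps)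
    also have "\<dots> \<le> ?y ^ 4 * (s' - s)\<^sup>2 + ?y ^ 4 * (t' - t)\<^sup>2"
    proof (intro add_mono mult_right_mono)
      show "l ^ 4 \<le> ?y ^ 4" using l by (intro power_mono) auto
      have "l\<^sup>2 \<le> ?y\<^sup>2" using l by (intro power_mono) auto
      also have "\<dots> \<le> ?y ^ 4" using add_inverse_ge_1[OF l] by (intro power_increasing) auto
      finally show "l\<^sup>2 \<le> ?y ^ 4" .
    qed auto
    finally have "norm (?G l) \<le> ?y ^ nat \<bar>k\<bar> * (2 * (?y ^ 4 * (s' - s)\<^sup>2 + ?y ^ 4 * (t' - t)\<^sup>2))"
      unfolding G norm_mult[of "of_real (l powi k)"] norm_of_real
      by (intro mult_mono abs_power_int_le l) (use l in auto)
    then show "norm (?G l) \<le> 2 * ((s' - s)\<^sup>2 + (t' - t)\<^sup>2) * ?y ^ (nat \<bar>k\<bar> + 4)"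
      by (simp add: power_add algebra_simps)
  qed
  finally show ?thesis .
qed

lemma bwave_has_derivative_pair:
  assumes a: "1 \<le> a" and s: "0 \<le> fst p"
  shows "((\<lambda>p. bwave a k (fst p) (snd p)) has_derivative
      (\<lambda>h. of_real (fst h) * (of_real (- 1 / (4 * a)) * bwave (a + 1) (k + 2) (fst p) (snd p))
         + of_real (snd h) * (\<i> * bwave a (k + 1) (fst p) (snd p)))) (at p within {0..} \<times> UNIV)"
proof (rule has_derivative_quadratic)
  show "bounded_linear (\<lambda>h. of_real (fst h) * (of_real (- 1 / (4 * a)) * bwave (a + 1) (k + 2) (fst p) (snd p))
         + of_real (snd h) * (\<i> * bwave a (k + 1) (fst p) (snd p)))"
    by (intro bounded_linear_add bounded_linear_mult_const bounded_linear_compose[OF bounded_linear_of_real]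
        bounded_linear_fst bounded_linear_snd)
  fix q :: "real \<times> real" assume "q \<in> {0..} \<times> UNIV"
  then have q: "0 \<le> fst q" by auto
  have "(norm (q - p))\<^sup>2 = (fst q - fst p)\<^sup>2 + (snd q - snd p)\<^sup>2"
    by (simp add: norm_prod_def)
  then show "norm (bwave a k (fst q) (snd q) - bwave a k (fst p) (snd p)
      - (of_real (fst (q - p)) * (of_real (- 1 / (4 * a)) * bwave (a + 1) (k + 2) (fst p) (snd p))
         + of_real (snd (q - p)) * (\<i> * bwave a (k + 1) (fst p) (snd p))))
      \<le> 2 * moment (nat \<bar>k\<bar> + 4) * (norm (q - p))\<^sup>2"
    using bwave_linearization[OF a s q, of k "snd q" "snd p"] by (simp add: algebra_simps)
qed

text \<open>The first argument \<open>X e \<bullet> X e\<close> is never negative, so the derivative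
  relative to the half-plane s >= 0 becomes a full derivative, even where X vanishes. The map X will
  be the identity, the projection of space-time to space, or a constant.\<close>

lemma bwave_has_derivative:
  fixes X :: "'e::real_normed_vector \<Rightarrow> 'a::real_inner"
  assumes a: "1 \<le> a" and X: "(X has_derivative X') (at e)" and \<tau>: "(\<tau> has_derivative L) (at e)"
  shows "((\<lambda>e. bwave a k (X e \<bullet> X e) (\<tau> e)) has_derivative
      (\<lambda>h. of_real (2 * (X e \<bullet> X' h)) * (of_real (- 1 / (4 * a)) * bwave (a + 1) (k + 2) (X e \<bullet> X e) (\<tau> e))
         + of_real (L h) * (\<i> * bwave a (k + 1) (X e \<bullet> X e) (\<tau> e)))) (at e)"
proof -
  let ?p = "\<lambda>e. (X e \<bullet> X e, \<tau> e)"
  have "(?p has_derivative (\<lambda>h. (X e \<bullet> X' h + X' h \<bullet> X e, L h))) (at e)"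
    by (intro has_derivative_Pair has_derivative_inner X \<tau>)
  then have p: "(?p has_derivative (\<lambda>h. (2 * (X e \<bullet> X' h), L h))) (at e within UNIV)"
    by (simp add: inner_commute)
  let ?g = "\<lambda>p. bwave a k (fst p) (snd p)"
  let ?g' = "\<lambda>p h. of_real (fst h) * (of_real (- 1 / (4 * a)) * bwave (a + 1) (k + 2) (fst p) (snd p))
         + of_real (snd h) * (\<i> * bwave a (k + 1) (fst p) (snd p))"
  have "(?g has_derivative ?g' q) (at q within {0..} \<times> UNIV)" if "q \<in> {0..} \<times> UNIV" for q
    using bwave_has_derivative_pair[OF a, of q k] that by auto
  moreover have "range ?p \<subseteq> {0..} \<times> UNIV" by auto
  ultimately show ?thesis
    using has_derivative_in_compose2[OF _ _ UNIV_I p, of "{0..} \<times> UNIV" ?g ?g'] by simp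
qed

section \<open>A class of functions closed under differentiation\<close>

text \<open>The closure of the waves under what the chain rule produces. Since derivatives stay in
  the class, smoothness and the decay of all derivatives follow by induction, without formulas for
  them. The parameters X and A cover space at a fixed time as well as space-time.\<close>

inductive_set wave_class :: "('e \<Rightarrow> 'a::real_inner) \<Rightarrow> ('e \<Rightarrow> real) set \<Rightarrow> ('e \<Rightarrow> complex) set"
  for X A where
  bwave: "1 \<le> a \<Longrightarrow> \<tau> \<in> A \<Longrightarrow> (\<lambda>e. bwave a k (X e \<bullet> X e) (\<tau> e)) \<in> wave_class X A"
| scale: "g \<in> wave_class X A \<Longrightarrow> (\<lambda>e. c * g e) \<in> wave_class X A"
| coord: "g \<in> wave_class X A \<Longrightarrow> (\<lambda>e. of_real (X e \<bullet> b) * g e) \<in> wave_class X A"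
| add: "g \<in> wave_class X A \<Longrightarrow> h \<in> wave_class X A \<Longrightarrow> (\<lambda>e. g e + h e) \<in> wave_class X A"

text \<open>Each phase in A has a derivative L that is the same at all points, so \<open>L h\<close>
  is a scalar for fixed h and falls under \<open>scale\<close>; the factor
  \<open>X e \<bullet> X h\<close> falls under \<open>coord\<close>.\<close>

lemma wave_class_has_derivative:
  fixes X :: "'e::real_normed_vector \<Rightarrow> 'a::real_inner"
  assumes X: "bounded_linear X"
    and A: "\<forall>\<tau>\<in>A. \<exists>L. \<forall>e. (\<tau> has_derivative L) (at e)"
    and "g \<in> wave_class X A"
  shows "\<exists>D. (\<forall>e. (g has_derivative D e) (at e)) \<and> (\<forall>h. (\<lambda>e. D e h) \<in> wave_class X A)"
  using assms(3)
proof induction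
  case (bwave a \<tau> k)
  then obtain L where L: "\<And>e. (\<tau> has_derivative L) (at e)" using A by blast
  let ?D = "\<lambda>e h. of_real (2 * (X e \<bullet> X h)) * (of_real (- 1 / (4 * a)) * bwave (a + 1) (k + 2) (X e \<bullet> X e) (\<tau> e))
         + of_real (L h) * (\<i> * bwave a (k + 1) (X e \<bullet> X e) (\<tau> e))"
  have "(\<lambda>e. ?D e h) \<in> wave_class X A" for h
  proof -
    have "(\<lambda>e. 2 * (of_real (X e \<bullet> X h) * (of_real (- 1 / (4 * a)) * bwave (a + 1) (k + 2) (X e \<bullet> X e) (\<tau> e)))
         + of_real (L h) * (\<i> * bwave a (k + 1) (X e \<bullet> X e) (\<tau> e))) \<in> wave_class X A"
      using bwave by (intro wave_class.intros) auto
    then show ?thesis by (simp add: mult.assoc)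
  qed
  moreover have "\<forall>e. ((\<lambda>e. bwave a k (X e \<bullet> X e) (\<tau> e)) has_derivative ?D e) (at e)"
    using bwave_has_derivative[OF bwave(1) bounded_linear_imp_has_derivative[OF X] L] by blast
  ultimately show ?case by (intro exI[of _ ?D]) blast
next
  case (scale g c)
  then obtain D where "\<forall>e. (g has_derivative D e) (at e)" "\<forall>h. (\<lambda>e. D e h) \<in> wave_class X A" by blast
  then show ?case
    by (intro exI[of _ "\<lambda>e h. c * D e h"] conjI allI has_derivative_mult_right wave_class.scale) auto
next
  case (coord g b)
  then obtain D where D: "\<And>e. (g has_derivative D e) (at e)" "\<And>h. (\<lambda>e. D e h) \<in> wave_class X A" by blast
  have "((\<lambda>e. of_real (X e \<bullet> b) * g e) has_derivative
      (\<lambda>h. of_real (X e \<bullet> b) * D e h + of_real (X h \<bullet> b) * g e)) (at e)" for e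
    by (auto intro!: derivative_eq_intros bounded_linear_imp_has_derivative[OF X] D
        simp: scaleR_conv_of_real)
  then show ?case
    using D(2) coord(1)
    by (intro exI[of _ "\<lambda>e h. of_real (X e \<bullet> b) * D e h + of_real (X h \<bullet> b) * g e"] conjI allI
        wave_class.add wave_class.coord wave_class.scale) auto
next
  case (add g h)
  then obtain D E where "\<forall>e. (g has_derivative D e) (at e)" "\<forall>h. (\<lambda>e. D e h) \<in> wave_class X A"
    "\<forall>e. (h has_derivative E e) (at e)" "\<forall>h. (\<lambda>e. E e h) \<in> wave_class X A" by blast
  then show ?case
    by (intro exI[of _ "\<lambda>e h. D e h + E e h"] conjI allI has_derivative_add wave_class.add) auto
qed

lemma partial_deriv_eq: "(g has_derivative D) (at x) \<Longrightarrow> partial_deriv b g x = D b"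
  by (simp add: partial_deriv_def frechet_derivative_at[symmetric])

lemma wave_class_C_k:
  fixes X :: "'e::euclidean_space \<Rightarrow> 'a::real_inner"
  assumes X: "bounded_linear X"
    and A: "\<forall>\<tau>\<in>A. \<exists>L. \<forall>e. (\<tau> has_derivative L) (at e)"
  shows "g \<in> wave_class X A \<Longrightarrow> partial_deriv b g \<in> wave_class X A"
    and "g \<in> wave_class X A \<Longrightarrow> C_k k g"
proof -
  have *: "partial_deriv b g \<in> wave_class X A \<and> g differentiable_on UNIV" if "g \<in> wave_class X A" for g b
  proof -
    obtain D where D: "\<forall>e. (g has_derivative D e) (at e)" "\<forall>h. (\<lambda>e. D e h) \<in> wave_class X A"
      using wave_class_has_derivative[OF X A \<open>g \<in> _\<close>] by blast
    then have "partial_deriv b g = (\<lambda>e. D e b)" by (auto simp: partial_deriv_eq)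
    then show ?thesis using D by (auto simp: differentiable_on_def differentiable_def)
  qed
  show "g \<in> wave_class X A \<Longrightarrow> partial_deriv b g \<in> wave_class X A" using * by blast
  show "g \<in> wave_class X A \<Longrightarrow> C_k k g"
    by (induction k arbitrary: g) (use * in \<open>auto intro: differentiable_imp_continuous_on\<close>)
qed

lemma wave_class_rapid_decay:
  fixes g :: "'a::euclidean_space \<Rightarrow> complex"
  assumes "g \<in> wave_class (\<lambda>x. x) {\<lambda>_. t}"
  shows "\<exists>C. \<forall>x. norm x ^ m * norm (g x) \<le> C"
  using assms
proof (induction arbitrary: m)
  case (bwave a \<tau> k)
  obtain C D where C: "\<And>s. 0 \<le> s \<Longrightarrow> norm (of_real (s ^ m) * bwave a k s t) \<le> C"
    and D: "\<And>s. 0 \<le> s \<Longrightarrow> norm (of_real (s ^ 0) * bwave a k s t) \<le> D"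
    using bwave_rapid_decay[OF bwave(1)] by meson
  have "norm x ^ m * norm (bwave a k (x \<bullet> x) t) \<le> C + D" for x :: 'a
  proof -
    \<comment> \<open>The decay already known is in powers of s = |x|^2; a bare power of |x| lies
      below s^m + 1.\<close>
    have "norm x ^ m \<le> (x \<bullet> x) ^ m + 1"
    proof (cases "norm x \<le> 1")
      case True
      then show ?thesis using power_le_one[of "norm x" m] by (simp add: add_increasing)
    next
      case False
      then have "norm x ^ m \<le> norm x ^ (2 * m)" by (intro power_increasing) auto
      then show ?thesis by (simp add: power_mult power2_norm_eq_inner)
    qed
    then have "norm x ^ m * norm (bwave a k (x \<bullet> x) t) \<le> ((x \<bullet> x) ^ m + 1) * norm (bwave a k (x \<bullet> x) t)"
      by (intro mult_right_mono) auto
    also have "\<dots> = norm (of_real ((x \<bullet> x) ^ m) * bwave a k (x \<bullet> x) t) + norm (of_real ((x \<bullet> x) ^ 0) * bwave a k (x \<bullet> x) t)"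
      by (simp add: norm_mult norm_power algebra_simps)
    also have "\<dots> \<le> C + D" by (intro add_mono C D) auto
    finally show ?thesis .
  qed
  then show ?case using bwave(2) by auto
next
  case (scale g c)
  then obtain C where "\<And>x. norm x ^ m * norm (g x) \<le> C" by blast
  then have "norm x ^ m * norm (c * g x) \<le> norm c * C" for x
    using mult_left_mono[of "norm x ^ m * norm (g x)" C "norm c"] by (simp add: norm_mult mult_ac)
  then show ?case by blast
next
  case (coord g b)
  \<comment> \<open>The coordinate factor costs one power of |x|, taken from the induction
    hypothesis at \<open>Suc m\<close>.\<close>
  then obtain C where C: "\<And>x. norm x ^ Suc m * norm (g x) \<le> C" by blast
  have "norm x ^ m * norm (of_real (x \<bullet> b) * g x) \<le> norm b * C" for x
  proof -
    have "norm x ^ m * norm (of_real (x \<bullet> b) * g x) = norm x ^ m * (\<bar>x \<bullet> b\<bar> * norm (g x))"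
      by (simp add: norm_mult)
    also have "\<dots> \<le> norm x ^ m * ((norm x * norm b) * norm (g x))"
      by (intro mult_left_mono mult_right_mono Cauchy_Schwarz_ineq2) auto
    also have "\<dots> = norm b * (norm x ^ Suc m * norm (g x))" by simp
    also have "\<dots> \<le> norm b * C" by (intro mult_left_mono C) auto
    finally show ?thesis .
  qed
  then show ?case by blast
next
  case (add g h)
  then obtain C D where CD: "\<And>x. norm x ^ m * norm (g x) \<le> C" "\<And>x. norm x ^ m * norm (h x) \<le> D" by meson
  have "norm x ^ m * norm (g x + h x) \<le> C + D" for x
    using mult_left_mono[OF norm_triangle_ineq[of "g x" "h x"], of "norm x ^ m"] CD[of x]
    by (simp add: distrib_left)
  then show ?case by blast
qed

lemma schwartz_bwave:
  assumes "1 \<le> a"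
  shows "schwartz (\<lambda>x::'a::euclidean_space. bwave a k (x \<bullet> x) t)"
  unfolding schwartz_def
proof (intro conjI allI impI)
  let ?W = "wave_class (\<lambda>x::'a. x) {\<lambda>_. t}"
  have A: "\<forall>\<tau>\<in>{\<lambda>_. t}. \<exists>L. \<forall>e::'a. (\<tau> has_derivative L) (at e)"
    by (auto intro!: exI[of _ "\<lambda>_. 0"])
  have f: "(\<lambda>x. bwave a k (x \<bullet> x) t) \<in> ?W"
    using wave_class.bwave[OF assms, of "\<lambda>_. t" "{\<lambda>_. t}" k "\<lambda>x::'a. x"] by simp
  then show "C_k m (\<lambda>x::'a. bwave a k (x \<bullet> x) t)" for m
    by (rule wave_class_C_k(2)[OF bounded_linear_ident A])
  fix bs :: "'a list" and m
  have "foldr partial_deriv bs (\<lambda>x. bwave a k (x \<bullet> x) t) \<in> ?W"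
    by (induction bs) (auto intro!: f wave_class_C_k(1)[OF bounded_linear_ident A])
  from wave_class_rapid_decay[OF this]
  show "bounded (range (\<lambda>x. norm x ^ m *\<^sub>R foldr partial_deriv bs (\<lambda>x. bwave a k (x \<bullet> x) t) x))"
    by (auto simp: bounded_iff)
qed

section \<open>Focusing solutions\<close>

text \<open>Summing (x . h)^2 over the basis gives s = |x|^2, and the recurrence turns s times
  parameter a + 2 into a difference of parameters a + 1 and a. The a + 1 part cancels the terms with
  \<open>h \<bullet> h\<close> exactly because the dimension is 2a. The two times serve the two
  halves of \<open>focusing\<close>.\<close>

lemma laplacian_bwave:
  fixes x :: "'a::euclidean_space"
  defines "a \<equiv> real DIM('a) / 2"
  assumes a: "1 \<le> a"
  shows "laplacian (\<lambda>x. c * bwave a k (x \<bullet> x) t + c' * bwave a k (x \<bullet> x) t') x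
       = - (c * bwave a (k + 2) (x \<bullet> x) t + c' * bwave a (k + 2) (x \<bullet> x) t')"
proof -
  define P where "P b j x = c * bwave b j (x \<bullet> x) t + c' * bwave b j (x \<bullet> x) t'" for b j and x :: 'a
  have dP: "(P b j has_derivative (\<lambda>h. of_real (2 * (x \<bullet> h)) * (of_real (- 1 / (4 * b)) * P (b + 1) (j + 2) x))) (at x)"
    if "1 \<le> b" for b j and x :: 'a
  proof -
    note d = bwave_has_derivative[OF that has_derivative_ident has_derivative_const]
    have "(P b j has_derivative (\<lambda>h. c * (of_real (2 * (x \<bullet> h)) * (of_real (- 1 / (4 * b)) * bwave (b + 1) (j + 2) (x \<bullet> x) t)
            + of_real 0 * (\<i> * bwave b (j + 1) (x \<bullet> x) t))
        + c' * (of_real (2 * (x \<bullet> h)) * (of_real (- 1 / (4 * b)) * bwave (b + 1) (j + 2) (x \<bullet> x) t')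
            + of_real 0 * (\<i> * bwave b (j + 1) (x \<bullet> x) t')))) (at x)"
      unfolding P_def by (intro has_derivative_add has_derivative_mult_right d)
    then show ?thesis
      by (rule has_derivative_eq_rhs) (auto simp: P_def algebra_simps)
  qed
  have P1: "partial_deriv h (P a k) = (\<lambda>x. of_real (2 * (x \<bullet> h)) * (of_real (- 1 / (4 * a)) * P (a + 1) (k + 2) x))" for h
    using partial_deriv_eq[OF dP[OF a]] by blast
  have dd: "partial_deriv h (partial_deriv h (P a k)) x
      = of_real (2 * (x \<bullet> h)) * (of_real (- 1 / (4 * a)) * (of_real (2 * (x \<bullet> h)) * (of_real (- 1 / (4 * (a + 1))) * P (a + 2) (k + 4) x)))
      + of_real (2 * (h \<bullet> h)) * (of_real (- 1 / (4 * a)) * P (a + 1) (k + 2) x)" for h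
  proof -
    have a1: "1 \<le> a + 1" using a by simp
    have "((\<lambda>x. of_real (2 * (x \<bullet> h)) * (of_real (- 1 / (4 * a)) * P (a + 1) (k + 2) x)) has_derivative
      (\<lambda>v. of_real (2 * (x \<bullet> h)) * (of_real (- 1 / (4 * a)) * (of_real (2 * (x \<bullet> v)) * (of_real (- 1 / (4 * (a + 1))) * P (a + 1 + 1) (k + 2 + 2) x)))
        + of_real (2 * (v \<bullet> h)) * (of_real (- 1 / (4 * a)) * P (a + 1) (k + 2) x))) (at x)"
      by (intro has_derivative_mult has_derivative_of_real has_derivative_mult_right dP a1
          has_derivative_inner_left has_derivative_ident)
    from partial_deriv_eq[OF this] show ?thesis
      unfolding P1 by (simp add: add.assoc)
  qed
  have "laplacian (P a k) x = (\<Sum>h\<in>Basis. of_real ((x \<bullet> h)\<^sup>2) * (of_real (1 / (4 * a * (a + 1))) * P (a + 2) (k + 4) x)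
      + - of_real (1 / (2 * a)) * P (a + 1) (k + 2) x)"
    unfolding laplacian_def
  proof (intro sum.cong refl)
    fix h :: 'a assume h: "h \<in> Basis"
    define \<alpha> \<beta> where "\<alpha> = - 1 / (4 * a)" and "\<beta> = - 1 / (4 * (a + 1))"
    have \<alpha>\<beta>: "1 / (4 * a * (a + 1)) = 4 * (\<alpha> * \<beta>)" "1 / (2 * a) = - 2 * \<alpha>"
      by (simp_all add: \<alpha>_def \<beta>_def)
    show "partial_deriv h (partial_deriv h (P a k)) x = of_real ((x \<bullet> h)\<^sup>2) * (of_real (1 / (4 * a * (a + 1))) * P (a + 2) (k + 4) x)
      + - of_real (1 / (2 * a)) * P (a + 1) (k + 2) x"
      unfolding dd \<alpha>\<beta> \<alpha>_def[symmetric] \<beta>_def[symmetric] using h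
      by (simp add: power2_eq_square)
  qed
  also have "\<dots> = of_real (\<Sum>h\<in>Basis. (x \<bullet> h)\<^sup>2) * (of_real (1 / (4 * a * (a + 1))) * P (a + 2) (k + 4) x)
      + of_nat DIM('a) * (- of_real (1 / (2 * a)) * P (a + 1) (k + 2) x)"
    by (simp only: sum.distrib sum_constant of_real_sum sum_distrib_right)
  also have "(\<Sum>h\<in>Basis. (x \<bullet> h)\<^sup>2) = x \<bullet> x"
    by (subst euclidean_inner[of x x]) (simp add: power2_eq_square)
  also have "of_nat DIM('a) = complex_of_real (2 * a)"
    by (simp add: a_def)
  also have "of_real (x \<bullet> x) * (of_real (1 / (4 * a * (a + 1))) * P (a + 2) (k + 4) x)
      = of_real (1 / (4 * a * (a + 1))) * (c * (of_real (x \<bullet> x) * bwave (a + 2) (k + 2 + 2) (x \<bullet> x) t)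
          + c' * (of_real (x \<bullet> x) * bwave (a + 2) (k + 2 + 2) (x \<bullet> x) t'))"
    by (simp add: P_def algebra_simps)
  also have "\<dots> = of_real (1 / (4 * a * (a + 1)) * (4 * a * (a + 1))) * (P (a + 1) (k + 2) x - P a (k + 2) x)"
  proof -
    define V K where "V = complex_of_real (4 * a * (a + 1))" and "K = complex_of_real (1 / (4 * a * (a + 1)))"
    have KV: "of_real (1 / (4 * a * (a + 1)) * (4 * a * (a + 1))) = K * V"
      unfolding V_def K_def by (rule of_real_mult)
    show ?thesis
      unfolding KV bwave_rec[OF a inner_ge_zero] P_def V_def[symmetric] K_def[symmetric]
      by (simp add: algebra_simps)
  qed
  also have "1 / (4 * a * (a + 1)) * (4 * a * (a + 1)) = 1"
    using a by simp
  also have "of_real 1 * (P (a + 1) (k + 2) x - P a (k + 2) x)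
      + of_real (2 * a) * (- of_real (1 / (2 * a)) * P (a + 1) (k + 2) x) = - P a (k + 2) x"
    using a by simp
  finally show ?thesis by (simp add: P_def[abs_def])
qed

text \<open>The solution \<open>focusing T\<close> comes from the frequency-side formula
  \<open>sin (t l) exp (- i T l)\<close>: the data consist of an incoming wave that focuses at the origin
  at time \<open>T\<close>, together with its mirror image.\<close>

definition focusing :: "real \<Rightarrow> 'a::euclidean_space \<Rightarrow> real \<Rightarrow> complex" where
  "focusing T x t = - \<i> / 2 * bwave (real DIM('a) / 2) 0 (x \<bullet> x) (t - T)
      + \<i> / 2 * bwave (real DIM('a) / 2) 0 (x \<bullet> x) (- t - T)"

text \<open>On the frequency side the time derivative of sin(t l) exp(-\<i> T l) at t = 0 is l
  exp(-\<i> T l), whence the exponent 1.\<close>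

definition focusing_data :: "real \<Rightarrow> 'a::euclidean_space \<Rightarrow> complex" where
  "focusing_data T x = bwave (real DIM('a) / 2) 1 (x \<bullet> x) (- T)"

lemma wave_solution_focusing:
  assumes "2 \<le> DIM('a::euclidean_space)"
  shows "wave_solution (focusing_data T :: 'a \<Rightarrow> complex) (focusing T)"
proof -
  define a where "a = real DIM('a) / 2"
  have a: "1 \<le> a" using assms by (simp add: a_def)
  \<comment> \<open>For fixed s the constant map \<open>sqrt s\<close> serves as X; the sign
    \<epsilon> will be 1 or -1, for the two directions of time.\<close>
  have dt: "((\<lambda>t. bwave a k s (\<epsilon> * t - T)) has_vector_derivative of_real \<epsilon> * (\<i> * bwave a (k + 1) s (\<epsilon> * t - T))) (at t)"
    if "0 \<le> s" for k s t \<epsilon>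
  proof -
    have "((\<lambda>t. \<epsilon> * t - T) has_derivative (\<lambda>h. \<epsilon> * h)) (at t)"
      by (auto intro!: derivative_eq_intros)
    from bwave_has_derivative[OF a has_derivative_const[of "sqrt s"] this, of k] that
    show ?thesis
      unfolding has_vector_derivative_def by (simp add: scaleR_conv_of_real mult_ac)
  qed
  have "((\<lambda>t. c * bwave a k s (t - T) + c' * bwave a k s (- t - T)) has_vector_derivative
      c * \<i> * bwave a (k + 1) s (t - T) + - c' * \<i> * bwave a (k + 1) s (- t - T)) (at t)"
    if "0 \<le> s" for c c' k s t
    using has_vector_derivative_add[OF has_vector_derivative_mult_right[OF dt[OF that, of k 1 t], of c]
        has_vector_derivative_mult_right[OF dt[OF that, of k "-1" t], of c']]
    by (simp add: mult.assoc)
  then have time: "time_deriv (\<lambda>(x::'a) t. c * bwave a k (x \<bullet> x) (t - T) + c' * bwave a k (x \<bullet> x) (- t - T))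
      = (\<lambda>x t. c * \<i> * bwave a (k + 1) (x \<bullet> x) (t - T) + - c' * \<i> * bwave a (k + 1) (x \<bullet> x) (- t - T))"
    for c c' k
    unfolding time_deriv_def by (intro ext vector_derivative_at) simp
  have foc: "focusing T = (\<lambda>(x::'a) t. - \<i> / 2 * bwave a 0 (x \<bullet> x) (t - T) + \<i> / 2 * bwave a 0 (x \<bullet> x) (- t - T))"
    by (simp add: focusing_def[abs_def] a_def)
  have t1: "time_deriv (focusing T) = (\<lambda>(x::'a) t. 1 / 2 * bwave a 1 (x \<bullet> x) (t - T) + 1 / 2 * bwave a 1 (x \<bullet> x) (- t - T))"
    unfolding foc time by simp
  have t2: "time_deriv (time_deriv (focusing T)) = (\<lambda>(x::'a) t. \<i> / 2 * bwave a 2 (x \<bullet> x) (t - T) + - \<i> / 2 * bwave a 2 (x \<bullet> x) (- t - T))"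
    unfolding t1 time by simp
  have "laplacian (\<lambda>y. focusing T y t) x = \<i> / 2 * bwave a 2 (x \<bullet> x) (t - T) + - \<i> / 2 * bwave a 2 (x \<bullet> x) (- t - T)" for x :: 'a and t
    unfolding foc using laplacian_bwave[where 'a = 'a, folded a_def, OF a, of "- \<i> / 2" 0 _ "\<i> / 2"] by simp
  moreover have "C_k 2 (\<lambda>(x::'a, t). focusing T x t)"
  proof -
    \<comment> \<open>Joint smoothness is membership in the class over space-time, with one affine
      phase for each of the two waves.\<close>
    let ?A = "{\<lambda>p::'a \<times> real. snd p - T, \<lambda>p. - snd p - T}"
    have "\<forall>e. ((\<lambda>p::'a \<times> real. snd p - T) has_derivative snd) (at e)"
      "\<forall>e. ((\<lambda>p::'a \<times> real. - snd p - T) has_derivative (\<lambda>h. - snd h)) (at e)"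
      by (auto intro!: derivative_eq_intros)
    then have "\<forall>\<tau>\<in>?A. \<exists>L. \<forall>e. (\<tau> has_derivative L) (at e)" by blast
    moreover have "(\<lambda>p::'a \<times> real. - \<i> / 2 * bwave a 0 (fst p \<bullet> fst p) (snd p - T)
        + \<i> / 2 * bwave a 0 (fst p \<bullet> fst p) (- snd p - T)) \<in> wave_class fst ?A"
      by (intro wave_class.add wave_class.scale wave_class.bwave[OF a]) auto
    ultimately have "C_k 2 (\<lambda>p::'a \<times> real. - \<i> / 2 * bwave a 0 (fst p \<bullet> fst p) (snd p - T)
        + \<i> / 2 * bwave a 0 (fst p \<bullet> fst p) (- snd p - T))"
      by (rule wave_class_C_k(2)[OF bounded_linear_fst])
    then show ?thesis unfolding foc case_prod_beta' .
  qed
  ultimately show ?thesis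
    unfolding wave_solution_def t2 unfolding t1 by (simp add: foc focusing_data_def a_def)
qed

section \<open>Decay in space, in time, and away from the light cone\<close>

text \<open>The Bessel decay is in l r, so small frequencies lose a factor l^(-b). The moments
  absorb it because the weight is flat at 0, and the bound is uniform in t because the phase has
  modulus 1.\<close>

lemma bwave_space_decay:
  assumes a: "1 \<le> a"
  obtains C where "\<And>r t. 0 < r \<Longrightarrow> norm (bwave a k (r\<^sup>2) t) \<le> C * r powr - (a - 1 / 2)"
proof -
  define b where "b = a - 1 / 2"
  have b: "0 < b" using a by (simp add: b_def)
  obtain K where K: "0 < K" "\<And>z. 0 < z \<Longrightarrow> \<bar>nbessel a (z\<^sup>2)\<bar> \<le> K * z powr - b"
    using nbessel_decay[OF a] unfolding b_def by blast
  define N where "N = nat \<lceil>b\<rceil>"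
  have "norm (bwave a k (r\<^sup>2) t) \<le> (K * r powr - b) * moment (nat \<bar>k\<bar> + N)" if r: "0 < r" for r t
    unfolding bwave_def
  proof (rule norm_wmeasure_integral_le)
    fix l :: real assume l: "0 < l"
    let ?y = "l + 1 / l"
    have "l powr - b = (1 / l) powr b"
      using l by (simp add: powr_minus_divide powr_divide)
    also have "\<dots> \<le> ?y powr b" using l b by (intro powr_mono2) auto
    also have "\<dots> \<le> ?y powr real N"
      using add_inverse_ge_1[OF l] by (intro powr_mono) (auto simp: N_def real_nat_ceiling_ge)
    also have "\<dots> = ?y ^ N" using add_inverse_ge_1[OF l] by (intro powr_realpow) linarith
    finally have lb: "l powr - b \<le> ?y ^ N" .
    have "\<bar>nbessel a (l\<^sup>2 * r\<^sup>2)\<bar> \<le> K * (l * r) powr - b"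
      using K(2)[of "l * r"] l r by (simp add: power_mult_distrib)
    also have "\<dots> = K * r powr - b * l powr - b"
      using l r by (simp add: powr_mult)
    also have "\<dots> \<le> K * r powr - b * ?y ^ N"
      using K(1) lb by (intro mult_left_mono) auto
    finally have j: "\<bar>nbessel a (l\<^sup>2 * r\<^sup>2)\<bar> \<le> K * r powr - b * ?y ^ N" .
    have "\<bar>l powi k\<bar> * \<bar>nbessel a (l\<^sup>2 * r\<^sup>2)\<bar> \<le> ?y ^ nat \<bar>k\<bar> * (K * r powr - b * ?y ^ N)"
      using l by (intro mult_mono abs_power_int_le j) auto
    then show "norm (of_real (l powi k * nbessel a (l\<^sup>2 * r\<^sup>2)) * cis (t * l)) \<le> K * r powr - b * ?y ^ (nat \<bar>k\<bar> + N)"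
      by (simp only: norm_mult norm_of_real norm_cis abs_mult mult_1_right power_add mult_ac)
  qed
  then show ?thesis
    by (intro that[of "K * moment (nat \<bar>k\<bar> + N)"]) (simp add: b_def mult_ac)
qed

text \<open>One integration by parts; the factor 1 + s pays for the s / (2a) in its last
  term.\<close>

lemma bwave_time_decay:
  assumes a: "1 \<le> a"
  obtains C where "0 \<le> C" "\<And>s t. 0 \<le> s \<Longrightarrow> \<bar>t\<bar> * norm (bwave a k s t) \<le> C * (1 + s)"
proof -
  let ?M = "\<lambda>k. moment (nat \<bar>k\<bar>)"
  define C where "C = ?M k + ?M (k - 2) + \<bar>of_int k\<bar> * ?M (k - 1) + ?M (k + 1)"
  have "\<bar>t\<bar> * norm (bwave a k s t) \<le> C * (1 + s)" if s: "0 \<le> s" for s t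
  proof -
    have a1: "1 \<le> a + 1" using a by simp
    have "\<bar>t\<bar> * norm (bwave a k s t) = norm (\<i> * of_real t * bwave a k s t)"
      by (simp add: norm_mult)
    also have "\<dots> \<le> norm (bwave a k s t) + norm (bwave a (k - 2) s t) + norm (of_int k * bwave a (k - 1) s t)
         + norm (of_real (s / (2 * a)) * bwave (a + 1) (k + 1) s t)"
      unfolding bwave_by_parts[OF a s]
      by (intro order_trans[OF norm_triangle_ineq] order_trans[OF norm_triangle_ineq4] add_mono order_refl)
    also have "\<dots> \<le> ?M k + ?M (k - 2) + \<bar>of_int k\<bar> * ?M (k - 1) + s * ?M (k + 1)"
    proof (intro add_mono norm_bwave_le a s)
      show "norm (of_int k * bwave a (k - 1) s t) \<le> \<bar>of_int k\<bar> * ?M (k - 1)"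
        unfolding norm_mult using norm_bwave_le[OF a s] by (simp add: mult_left_mono)
      have "norm (complex_of_real (s / (2 * a))) \<le> s"
        using a s by (simp add: norm_divide divide_le_eq mult_le_cancel_left1)
      then show "norm (of_real (s / (2 * a)) * bwave (a + 1) (k + 1) s t) \<le> s * ?M (k + 1)"
        unfolding norm_mult using s by (intro mult_mono norm_bwave_le a1) auto
    qed
    also have "\<dots> \<le> C * (1 + s)"
      using s by (simp add: C_def distrib_left distrib_right moment_nonneg mult_nonneg_nonneg)
    finally show ?thesis .
  qed
  moreover have "0 \<le> C" by (simp add: C_def moment_nonneg)
  ultimately show ?thesis using that by blast
qed

text \<open>A second integration by parts, in each term of the first. The data enter multiplied by
  T, so one power of decay would leave that product merely bounded at a fixed point; two make it
  tend to 0.\<close>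

lemma bwave_time_decay2:
  assumes a: "1 \<le> a"
  obtains C where "0 \<le> C" "\<And>s t. 0 \<le> s \<Longrightarrow> t\<^sup>2 * norm (bwave a k s t) \<le> C * (1 + s)\<^sup>2"
proof -
  have a1: "1 \<le> a + 1" using a by simp
  obtain C1 where C1: "0 \<le> C1" "\<And>s t. 0 \<le> s \<Longrightarrow> \<bar>t\<bar> * norm (bwave a k s t) \<le> C1 * (1 + s)"
    using bwave_time_decay[OF a] by blast
  obtain C2 where C2: "0 \<le> C2" "\<And>s t. 0 \<le> s \<Longrightarrow> \<bar>t\<bar> * norm (bwave a (k - 2) s t) \<le> C2 * (1 + s)"
    using bwave_time_decay[OF a] by blast
  obtain C3 where C3: "0 \<le> C3" "\<And>s t. 0 \<le> s \<Longrightarrow> \<bar>t\<bar> * norm (bwave a (k - 1) s t) \<le> C3 * (1 + s)"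
    using bwave_time_decay[OF a] by blast
  obtain C4 where C4: "0 \<le> C4" "\<And>s t. 0 \<le> s \<Longrightarrow> \<bar>t\<bar> * norm (bwave (a + 1) (k + 1) s t) \<le> C4 * (1 + s)"
    using bwave_time_decay[OF a1] by blast
  define C where "C = C1 + C2 + \<bar>of_int k\<bar> * C3 + C4"
  have "t\<^sup>2 * norm (bwave a k s t) \<le> C * (1 + s)\<^sup>2" if s: "0 \<le> s" for s t
  proof -
    have "t\<^sup>2 * norm (bwave a k s t) = \<bar>t\<bar> * norm (\<i> * of_real t * bwave a k s t)"
      by (simp add: norm_mult power2_eq_square flip: abs_mult mult.assoc)
    also have "\<dots> \<le> \<bar>t\<bar> * (norm (bwave a k s t) + norm (bwave a (k - 2) s t) + norm (of_int k * bwave a (k - 1) s t)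
         + norm (of_real (s / (2 * a)) * bwave (a + 1) (k + 1) s t))"
      unfolding bwave_by_parts[OF a s]
      by (intro mult_left_mono order_trans[OF norm_triangle_ineq] order_trans[OF norm_triangle_ineq4] add_mono order_refl) auto
    also have "\<dots> = \<bar>t\<bar> * norm (bwave a k s t) + \<bar>t\<bar> * norm (bwave a (k - 2) s t)
        + \<bar>of_int k\<bar> * (\<bar>t\<bar> * norm (bwave a (k - 1) s t)) + s / (2 * a) * (\<bar>t\<bar> * norm (bwave (a + 1) (k + 1) s t))"
      using a s by (simp add: norm_mult norm_divide algebra_simps)
    also have "\<dots> \<le> C1 * (1 + s) + C2 * (1 + s) + \<bar>of_int k\<bar> * (C3 * (1 + s)) + s * (C4 * (1 + s))"
    proof (intro add_mono C1 C2 mult_left_mono C3 s)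
      have "s / (2 * a) \<le> s" using a s by (simp add: divide_le_eq mult_le_cancel_left1)
      then show "s / (2 * a) * (\<bar>t\<bar> * norm (bwave (a + 1) (k + 1) s t)) \<le> s * (C4 * (1 + s))"
        using s by (intro mult_mono C4) auto
    qed auto
    also have "\<dots> \<le> C1 * ((1 + s) * (1 + s)) + C2 * ((1 + s) * (1 + s)) + \<bar>of_int k\<bar> * (C3 * ((1 + s) * (1 + s))) + C4 * ((1 + s) * (1 + s))"
    proof -
      have "1 + s \<le> (1 + s) * (1 + s)" "s * (1 + s) \<le> (1 + s) * (1 + s)" using s by (auto simp: algebra_simps)
      then have "C4 * (s * (1 + s)) \<le> C4 * ((1 + s) * (1 + s))"
        "C1 * (1 + s) \<le> C1 * ((1 + s) * (1 + s))" "C2 * (1 + s) \<le> C2 * ((1 + s) * (1 + s))"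
        "\<bar>of_int k\<bar> * (C3 * (1 + s)) \<le> \<bar>of_int k\<bar> * (C3 * ((1 + s) * (1 + s)))"
        using C1(1) C2(1) C3(1) C4(1) by (auto intro!: mult_left_mono simp del: distrib_left distrib_right)
      moreover have "s * (C4 * (1 + s)) = C4 * (s * (1 + s))" by simp
      ultimately show ?thesis by linarith
    qed
    also have "\<dots> = C * (1 + s)\<^sup>2" by (simp add: C_def power2_eq_square algebra_simps)
    finally show ?thesis .
  qed
  moreover have "0 \<le> C" using C1(1) C2(1) C3(1) C4(1) by (simp add: C_def)
  ultimately show ?thesis using that by blast
qed

text \<open>The factor \<open>s - t\<^sup>2\<close> is the gain near the light cone: the second-order terms of the
  two integrations by parts, in \<open>s\<close> and in \<open>t\<close>, cancel.\<close>

lemma bwave_cone_identity: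
  assumes a: "1 \<le> a" and s: "0 \<le> s"
  shows "of_real (s - t\<^sup>2) * bwave a 1 s t
       = of_real (s / (2 * a)) * (bwave (a + 1) 2 s t - bwave (a + 1) 0 s t - of_real (2 - 2 * a) * bwave (a + 1) 1 s t)
         + \<i> * of_real t * (bwave a 1 s t - bwave a (- 1) s t - bwave a 0 s t)"
proof -
  define w where "w = complex_of_real (s / (2 * a))"
  have w: "complex_of_real s = w * of_real (2 * a)"
    using a by (simp add: w_def)
  have 1: "\<i> * of_real t * bwave a 1 s t = bwave a 1 s t - bwave a (- 1) s t - bwave a 0 s t + w * bwave (a + 1) 2 s t"
    using bwave_by_parts[OF a s, of t 1] by (simp add: w_def)
  have 2: "of_real (2 * a) * bwave a 1 s t
       = bwave (a + 1) 2 s t - bwave (a + 1) 0 s t - of_real (2 - 2 * a) * bwave (a + 1) 1 s t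
         - \<i> * of_real t * bwave (a + 1) 2 s t"
    using bwave_by_parts'[OF a s, of 1 t] by simp
  \<comment> \<open>The s part uses the identity that raises the parameter, the t^2 part the other
    one; the multiples of \<open>bwave (a + 1) 2 s t\<close> by \<i> t w then have opposite
    signs.\<close>
  have "of_real (s - t\<^sup>2) * bwave a 1 s t = w * (of_real (2 * a) * bwave a 1 s t) + \<i> * of_real t * (\<i> * of_real t * bwave a 1 s t)"
    by (simp add: w power2_eq_square algebra_simps)
  also have "\<dots> = w * (bwave (a + 1) 2 s t - bwave (a + 1) 0 s t - of_real (2 - 2 * a) * bwave (a + 1) 1 s t)
         + \<i> * of_real t * (bwave a 1 s t - bwave a (- 1) s t - bwave a 0 s t)"
    unfolding 1 2 by (simp add: algebra_simps)
  finally show ?thesis by (simp add: w_def)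
qed

text \<open>The right-hand side of the cone identity is of size (r + T) r^(-b), and |r^2 - T^2| = (r
  + T) |r - T|, so r + T can be divided out. The decay in space supplies the 1 in the
  denominator.\<close>

lemma bwave_cone_decay:
  assumes a: "1 \<le> a"
  obtains C where "0 \<le> C"
    "\<And>r T. 0 < r \<Longrightarrow> 0 < T \<Longrightarrow> norm (bwave a 1 (r\<^sup>2) (- T)) \<le> C * r powr - (a - 1 / 2) / (1 + \<bar>r - T\<bar>)"
proof -
  define b where "b = a - 1 / 2"
  have a1: "1 \<le> a + 1" using a by simp
  have A: "\<exists>C\<ge>0. \<forall>r t. 0 < r \<longrightarrow> norm (bwave a k (r\<^sup>2) t) \<le> C * r powr - b" if ab: "1 \<le> a" "b = a - 1 / 2" for a b k
  proof -
    obtain C where C: "\<And>r t. 0 < r \<Longrightarrow> norm (bwave a k (r\<^sup>2) t) \<le> C * r powr - b"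
      using bwave_space_decay[OF ab(1)] unfolding ab(2) by blast
    moreover have "0 \<le> C" using C[of 1 0] norm_ge_zero[of "bwave a k (1\<^sup>2) 0"] by (simp del: norm_ge_zero)
    ultimately show ?thesis by blast
  qed
  have bb: "b + 1 = (a + 1) - 1 / 2" by (simp add: b_def)
  obtain D where D: "0 \<le> D k" "0 < r \<Longrightarrow> norm (bwave a k (r\<^sup>2) t) \<le> D k * r powr - b" for k r t
    using A[OF a b_def] by metis
  obtain E where E: "0 \<le> E k" "0 < r \<Longrightarrow> norm (bwave (a + 1) k (r\<^sup>2) t) \<le> E k * r powr - (b + 1)" for k r t
    using A[OF a1 bb] by metis
  define C1 where "C1 = E 2 + E 0 + \<bar>2 - 2 * a\<bar> * E 1"
  define C2 where "C2 = D 1 + D (- 1) + D 0"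
  have C12: "0 \<le> C1" "0 \<le> C2" by (auto simp: C1_def C2_def D E)
  have "norm (bwave a 1 (r\<^sup>2) (- T)) \<le> (C1 + C2 + D 1) * r powr - b / (1 + \<bar>r - T\<bar>)" if r: "0 < r" "0 < T" for r T
  proof -
    let ?p = "r powr - b"
    \<comment> \<open>Parameter a + 1 brings one more power of decay, which reduces the factor r^2
      of the identity to r.\<close>
    have rp: "r\<^sup>2 * r powr - (b + 1) = r * ?p"
      using r by (simp add: power2_eq_square powr_diff powr_minus field_simps)
    have "\<bar>r\<^sup>2 - T\<^sup>2\<bar> * norm (bwave a 1 (r\<^sup>2) (- T)) = norm (of_real (r\<^sup>2 - (- T)\<^sup>2) * bwave a 1 (r\<^sup>2) (- T))"
      unfolding norm_mult norm_of_real by simp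
    also have "\<dots> \<le> norm (of_real (r\<^sup>2 / (2 * a)) * (bwave (a + 1) 2 (r\<^sup>2) (- T) - bwave (a + 1) 0 (r\<^sup>2) (- T) - of_real (2 - 2 * a) * bwave (a + 1) 1 (r\<^sup>2) (- T)))
         + norm (\<i> * of_real (- T) * (bwave a 1 (r\<^sup>2) (- T) - bwave a (- 1) (r\<^sup>2) (- T) - bwave a 0 (r\<^sup>2) (- T)))"
      unfolding bwave_cone_identity[OF a zero_le_power2] by (rule norm_triangle_ineq)
    also have "\<dots> \<le> r\<^sup>2 * (C1 * r powr - (b + 1)) + T * (C2 * ?p)"
    proof (intro add_mono)
      have "norm (bwave (a + 1) 2 (r\<^sup>2) (- T) - bwave (a + 1) 0 (r\<^sup>2) (- T) - of_real (2 - 2 * a) * bwave (a + 1) 1 (r\<^sup>2) (- T))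
          \<le> norm (bwave (a + 1) 2 (r\<^sup>2) (- T)) + norm (bwave (a + 1) 0 (r\<^sup>2) (- T)) + \<bar>2 - 2 * a\<bar> * norm (bwave (a + 1) 1 (r\<^sup>2) (- T))"
        by (intro order_trans[OF norm_triangle_ineq4] add_mono order_refl) (simp only: norm_mult norm_of_real order_refl)
      also have "\<dots> \<le> E 2 * r powr - (b + 1) + E 0 * r powr - (b + 1) + \<bar>2 - 2 * a\<bar> * (E 1 * r powr - (b + 1))"
        by (intro add_mono mult_left_mono E r) auto
      finally have 1: "norm (bwave (a + 1) 2 (r\<^sup>2) (- T) - bwave (a + 1) 0 (r\<^sup>2) (- T) - of_real (2 - 2 * a) * bwave (a + 1) 1 (r\<^sup>2) (- T))
          \<le> C1 * r powr - (b + 1)" by (simp add: C1_def algebra_simps)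
      have "norm (complex_of_real (r\<^sup>2 / (2 * a))) \<le> r\<^sup>2"
        unfolding norm_of_real using a by (simp add: divide_le_eq mult_le_cancel_left1)
      then show "norm (of_real (r\<^sup>2 / (2 * a)) * (bwave (a + 1) 2 (r\<^sup>2) (- T) - bwave (a + 1) 0 (r\<^sup>2) (- T) - of_real (2 - 2 * a) * bwave (a + 1) 1 (r\<^sup>2) (- T)))
          \<le> r\<^sup>2 * (C1 * r powr - (b + 1))"
        unfolding norm_mult[of "of_real (r\<^sup>2 / (2 * a))"] using 1 by (intro mult_mono) auto
      have "norm (bwave a 1 (r\<^sup>2) (- T) - bwave a (- 1) (r\<^sup>2) (- T) - bwave a 0 (r\<^sup>2) (- T))
          \<le> norm (bwave a 1 (r\<^sup>2) (- T)) + norm (bwave a (- 1) (r\<^sup>2) (- T)) + norm (bwave a 0 (r\<^sup>2) (- T))"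
        by (intro order_trans[OF norm_triangle_ineq4] add_mono order_refl)
      also have "\<dots> \<le> D 1 * ?p + D (- 1) * ?p + D 0 * ?p"
        by (intro add_mono D r)
      finally have "norm (bwave a 1 (r\<^sup>2) (- T) - bwave a (- 1) (r\<^sup>2) (- T) - bwave a 0 (r\<^sup>2) (- T)) \<le> C2 * ?p"
        by (simp add: C2_def algebra_simps)
      then show "norm (\<i> * of_real (- T) * (bwave a 1 (r\<^sup>2) (- T) - bwave a (- 1) (r\<^sup>2) (- T) - bwave a 0 (r\<^sup>2) (- T))) \<le> T * (C2 * ?p)"
        unfolding norm_mult norm_of_real using r by simp
    qed
    also have "\<dots> = C1 * (r * ?p) + C2 * (T * ?p)"
      unfolding rp[symmetric] by (simp add: algebra_simps)
    also have "\<dots> \<le> C1 * ((r + T) * ?p) + C2 * ((r + T) * ?p)"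
      using C12 r by (intro add_mono mult_left_mono mult_right_mono) auto
    finally have "\<bar>r\<^sup>2 - T\<^sup>2\<bar> * norm (bwave a 1 (r\<^sup>2) (- T)) \<le> (r + T) * ((C1 + C2) * ?p)"
      by (simp add: algebra_simps)
    moreover have "\<bar>r\<^sup>2 - T\<^sup>2\<bar> = (r + T) * \<bar>r - T\<bar>"
    proof -
      have "r\<^sup>2 - T\<^sup>2 = (r + T) * (r - T)" by (simp add: power2_eq_square algebra_simps)
      then show ?thesis using r by (simp add: abs_mult)
    qed
    ultimately have "\<bar>r - T\<bar> * norm (bwave a 1 (r\<^sup>2) (- T)) \<le> (C1 + C2) * ?p"
      using r by (simp add: mult.assoc)
    then have "(1 + \<bar>r - T\<bar>) * norm (bwave a 1 (r\<^sup>2) (- T)) \<le> (C1 + C2 + D 1) * ?p"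
      using D(2)[OF r(1), of 1 "- T"] by (simp add: distrib_right)
    moreover have "0 < 1 + \<bar>r - T\<bar>" by simp
    ultimately show ?thesis by (simp only: pos_le_divide_eq mult.commute)
  qed
  moreover have "0 \<le> C1 + C2 + D 1" using C12 D(1)[of 1] by linarith
  ultimately show ?thesis
    unfolding b_def using that by blast
qed

section \<open>Radial integrals\<close>

text \<open>Polar coordinates for radial functions: half-lines generate the Borel sets, and up to a
  radius u >= 0 both sides give the volume of a ball, as the density is the derivative of that
  volume.\<close>

lemma distr_norm_lborel:
  "distr lborel borel (norm :: 'a::euclidean_space \<Rightarrow> real)
   = density lborel (\<lambda>r. ennreal (unit_ball_vol DIM('a) * DIM('a) * r ^ (DIM('a) - 1) * indicator {0..} r))"
  (is "?L = density lborel ?f")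
proof (rule measure_eqI_generator_eq[where E = "range atMost" and \<Omega> = UNIV and A = "\<lambda>i. {..real i}"])
  let ?n = "DIM('a)" and ?v = "unit_ball_vol (real DIM('a))"
  have L: "emeasure ?L {..u} = ennreal (?v * u ^ ?n)" if "0 \<le> u" for u
  proof -
    have "emeasure ?L {..u} = emeasure lborel (cball (0::'a) u)"
      by (subst emeasure_distr) (auto intro!: arg_cong[where f = "emeasure lborel"])
    then show ?thesis using that by (simp add: emeasure_cball)
  qed
  have R: "emeasure (density lborel ?f) {..u} = ennreal (?v * u ^ ?n)" if u: "0 \<le> u" for u
  proof -
    have "emeasure (density lborel ?f) {..u} = (\<integral>\<^sup>+r. ennreal (?v * ?n * r ^ (?n - 1)) * indicator {0..u} r \<partial>lborel)"
      by (subst emeasure_density) (auto intro!: nn_integral_cong simp: indicator_def)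
    also have "\<dots> = ?v * u ^ ?n - ?v * 0 ^ ?n"
      by (rule nn_integral_FTC_Icc) (use u in \<open>auto intro!: derivative_eq_intros mult_nonneg_nonneg\<close>)
    finally show ?thesis by (simp add: zero_power)
  qed
  fix X :: "real set" assume "X \<in> range atMost"
  then obtain u where X: "X = {..u}" by auto
  show "emeasure ?L X = emeasure (density lborel ?f) X"
  proof (cases "0 \<le> u")
    case True
    then show ?thesis using L R X by simp
  next
    case False
    have "norm -` {..u} = ({} :: 'a set)"
      using False by (auto dest: order_trans[OF norm_ge_zero])
    then have "emeasure ?L X = 0"
      using X by (subst emeasure_distr) auto
    moreover have "emeasure (density lborel ?f) X = 0"
      using X False by (subst emeasure_density) (auto intro!: nn_integral_0_iff_AE[THEN iffD2] simp: indicator_def)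
    ultimately show ?thesis by simp
  qed
next
  show "emeasure ?L {..real i} \<noteq> \<infinity>" for i
  proof -
    have "emeasure ?L {..real i} = emeasure lborel (cball (0::'a) (real i))"
      by (subst emeasure_distr) (auto intro!: arg_cong[where f = "emeasure lborel"])
    then show ?thesis by (simp add: emeasure_cball)
  qed
  show "(\<Union>i. {..real i}) = UNIV"
    by (auto intro: real_arch_simple)
  show "Int_stable (range atMost :: real set set)"
    by (auto simp: Int_stable_def)
qed (auto simp: borel_eq_atMost)

lemma nn_integral_radial:
  fixes h :: "real \<Rightarrow> ennreal"
  assumes [measurable]: "h \<in> borel_measurable borel"
  shows "(\<integral>\<^sup>+(x::'a::euclidean_space). h (norm x) \<partial>lborel)
       = (\<integral>\<^sup>+r. ennreal (unit_ball_vol DIM('a) * DIM('a) * r ^ (DIM('a) - 1) * indicator {0..} r) * h r \<partial>lborel)"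
proof -
  have "(\<integral>\<^sup>+(x::'a). h (norm x) \<partial>lborel) = (\<integral>\<^sup>+r. h r \<partial>distr lborel borel (norm :: 'a \<Rightarrow> real))"
    by (subst nn_integral_distr) auto
  also have "\<dots> = (\<integral>\<^sup>+r. ennreal (unit_ball_vol DIM('a) * DIM('a) * r ^ (DIM('a) - 1) * indicator {0..} r) * h r \<partial>lborel)"
    unfolding distr_norm_lborel by (rule nn_integral_density) auto
  finally show ?thesis .
qed

lemma nn_integral_one_plus_abs_powr_finite:
  assumes q: "1 < q"
  shows "(\<integral>\<^sup>+y. ennreal ((1 + \<bar>y\<bar>) powr - q) \<partial>lborel) < \<infinity>"
proof -
  let ?I = "\<integral>\<^sup>+y. ennreal ((1 + \<bar>y\<bar>) powr - q) * indicator {0..} y \<partial>lborel"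
  have "?I = (\<integral>\<^sup>+y. ennreal ((1 + y) powr - q) * indicator {0..} y \<partial>lborel)"
    by (intro nn_integral_cong) (auto simp: indicator_def)
  also have "\<dots> = 0 - (- ((1 + 0) powr (1 - q) / (q - 1)))"
  proof (rule nn_integral_FTC_atLeast)
    show "((\<lambda>y. - ((1 + y) powr (1 - q) / (q - 1))) has_real_derivative (1 + y) powr - q) (at y)" if "0 \<le> y" for y
    proof -
      have "((\<lambda>y. - ((1 + y) powr (1 - q) / (q - 1))) has_real_derivative - ((1 - q) * (1 + y) powr - q / (q - 1))) (at y)"
        using that q by (auto intro!: derivative_eq_intros)
      also have "- ((1 - q) * (1 + y) powr - q / (q - 1)) = (1 + y) powr - q"
        using q by (simp add: nonzero_divide_eq_eq neg_eq_iff_add_eq_0 minus_divide_left algebra_simps)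
      finally show ?thesis .
    qed
    have "((\<lambda>y. (1 + y) powr (1 - q)) \<longlongrightarrow> 0) at_top"
      by (rule tendsto_neg_powr) (use q in \<open>auto intro!: filterlim_tendsto_add_at_top filterlim_ident\<close>)
    from tendsto_minus[OF tendsto_divide[OF this tendsto_const[of "q - 1"]]] q
    show "((\<lambda>y. - ((1 + y) powr (1 - q) / (q - 1))) \<longlongrightarrow> 0) at_top" by simp
  qed auto
  finally have fin: "?I < \<infinity>" by simp
  have "(\<integral>\<^sup>+y. ennreal ((1 + \<bar>y\<bar>) powr - q) \<partial>lborel)
      \<le> (\<integral>\<^sup>+y. ennreal ((1 + \<bar>y\<bar>) powr - q) * indicator {0..} y + ennreal ((1 + \<bar>y\<bar>) powr - q) * indicator {0..} (- y) \<partial>lborel)"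
    by (intro nn_integral_mono) (auto simp: indicator_def)
  also have "\<dots> = ?I + (\<integral>\<^sup>+y. ennreal ((1 + \<bar>- y\<bar>) powr - q) * indicator {0..} (- y) \<partial>lborel)"
    by (subst nn_integral_add) auto
  also have "(\<integral>\<^sup>+y. ennreal ((1 + \<bar>- y\<bar>) powr - q) * indicator {0..} (- y) \<partial>lborel) = ?I"
    by (subst (2) nn_integral_real_affine[where c = "- 1" and t = 0]) auto
  also have "?I + ?I < \<infinity>" using fin by simp
  finally show ?thesis .
qed

section \<open>The counterexample\<close>

lemma focusing_data_bounds:
  assumes "2 \<le> DIM('a::euclidean_space)"
  obtains C where "0 \<le> C"
    "\<And>T x. 0 < T \<Longrightarrow> T\<^sup>2 * norm (focusing_data T (x::'a)) \<le> C * (1 + (norm x)\<^sup>2)\<^sup>2"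
    "\<And>T x. 0 < T \<Longrightarrow> x \<noteq> 0 \<Longrightarrow> norm (focusing_data T (x::'a))
        \<le> C * norm x powr - ((real DIM('a) - 1) / 2) / (1 + \<bar>norm x - T\<bar>)"
proof -
  define a where "a = real DIM('a) / 2"
  have a: "1 \<le> a" using assms by (simp add: a_def)
  have b: "a - 1 / 2 = (real DIM('a) - 1) / 2" by (simp add: a_def diff_divide_distrib)
  obtain C1 where C1: "0 \<le> C1" "\<And>s t. 0 \<le> s \<Longrightarrow> t\<^sup>2 * norm (bwave a 1 s t) \<le> C1 * (1 + s)\<^sup>2"
    using bwave_time_decay2[OF a] by blast
  obtain C2 where C2: "0 \<le> C2"
    "\<And>r T. 0 < r \<Longrightarrow> 0 < T \<Longrightarrow> norm (bwave a 1 (r\<^sup>2) (- T)) \<le> C2 * r powr - ((real DIM('a) - 1) / 2) / (1 + \<bar>r - T\<bar>)"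
    using bwave_cone_decay[OF a] unfolding b by blast
  show ?thesis
  proof (rule that[of "C1 + C2"])
    show "0 \<le> C1 + C2" using C1 C2 by simp
    fix T :: real and x :: 'a assume T: "0 < T"
    have f: "focusing_data T x = bwave a 1 ((norm x)\<^sup>2) (- T)"
      by (simp add: focusing_data_def a_def power2_norm_eq_inner)
    have "T\<^sup>2 * norm (focusing_data T x) \<le> C1 * (1 + (norm x)\<^sup>2)\<^sup>2"
      using C1(2)[of "(norm x)\<^sup>2" "- T"] by (simp add: f)
    also have "\<dots> \<le> (C1 + C2) * (1 + (norm x)\<^sup>2)\<^sup>2"
      using C2 by (intro mult_right_mono) auto
    finally show "T\<^sup>2 * norm (focusing_data T x) \<le> (C1 + C2) * (1 + (norm x)\<^sup>2)\<^sup>2" .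
    assume "x \<noteq> 0"
    then have "norm (focusing_data T x) \<le> C2 * norm x powr - ((real DIM('a) - 1) / 2) / (1 + \<bar>norm x - T\<bar>)"
      unfolding f using C2(2) T by simp
    also have "\<dots> \<le> (C1 + C2) * norm x powr - ((real DIM('a) - 1) / 2) / (1 + \<bar>norm x - T\<bar>)"
      using C1 by (intro divide_right_mono mult_right_mono) auto
    finally show "norm (focusing_data T x) \<le> (C1 + C2) * norm x powr - ((real DIM('a) - 1) / 2) / (1 + \<bar>norm x - T\<bar>)" .
  qed
qed

lemma schwartz_focusing_data:
  assumes "2 \<le> DIM('a::euclidean_space)"
  shows "schwartz (focusing_data T :: 'a \<Rightarrow> complex)"
  unfolding focusing_data_def[abs_def] by (rule schwartz_bwave) (use assms in simp)

lemma continuous_on_focusing_data: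
  assumes "2 \<le> DIM('a::euclidean_space)"
  shows "continuous_on UNIV (focusing_data T :: 'a \<Rightarrow> complex)"
proof -
  have "C_k 0 (focusing_data T :: 'a \<Rightarrow> complex)"
    using schwartz_focusing_data[OF assms] unfolding schwartz_def by blast
  then show ?thesis by simp
qed

lemma nn_integral_radial_powr_finite:
  assumes "real DIM('a::euclidean_space) < q"
  shows "(\<integral>\<^sup>+(x::'a). ennreal (c * (1 + norm x) powr - q) \<partial>lborel) < \<infinity>"
proof -
  let ?n = "DIM('a)" and ?V = "unit_ball_vol DIM('a) * DIM('a)"
  let ?h = "\<lambda>r. ennreal (c * (1 + \<bar>r\<bar>) powr - q)"
  have "(\<integral>\<^sup>+(x::'a). ennreal (c * (1 + norm x) powr - q) \<partial>lborel) = (\<integral>\<^sup>+(x::'a). ?h (norm x) \<partial>lborel)"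
    by simp
  also have "\<dots> = (\<integral>\<^sup>+r. ennreal (?V * r ^ (?n - 1) * indicator {0..} r) * ?h r \<partial>lborel)"
    by (rule nn_integral_radial) measurable
  also have "\<dots> \<le> (\<integral>\<^sup>+r. ennreal (?V * \<bar>c\<bar>) * ennreal ((1 + \<bar>r\<bar>) powr - (q - real (?n - 1))) \<partial>lborel)"
  proof (rule nn_integral_mono)
    fix r :: real
    show "ennreal (?V * r ^ (?n - 1) * indicator {0..} r) * ?h r
        \<le> ennreal (?V * \<bar>c\<bar>) * ennreal ((1 + \<bar>r\<bar>) powr - (q - real (?n - 1)))"
    proof (cases "0 \<le> r")
      case True
      have "r ^ (?n - 1) \<le> (1 + \<bar>r\<bar>) powr real (?n - 1)"
        using True by (subst powr_realpow) (auto intro!: power_mono)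
      then have "r ^ (?n - 1) * (1 + \<bar>r\<bar>) powr - q \<le> (1 + \<bar>r\<bar>) powr real (?n - 1) * (1 + \<bar>r\<bar>) powr - q"
        by (rule mult_right_mono) simp
      also have "\<dots> = (1 + \<bar>r\<bar>) powr - (q - real (?n - 1))"
        by (simp flip: powr_add)
      finally have "?V * \<bar>c\<bar> * (r ^ (?n - 1) * (1 + \<bar>r\<bar>) powr - q) \<le> ?V * \<bar>c\<bar> * (1 + \<bar>r\<bar>) powr - (q - real (?n - 1))"
        by (intro mult_left_mono) auto
      moreover have "?V * r ^ (?n - 1) * (c * (1 + \<bar>r\<bar>) powr - q) \<le> ?V * \<bar>c\<bar> * (r ^ (?n - 1) * (1 + \<bar>r\<bar>) powr - q)"
      proof -
        have "?V * r ^ (?n - 1) * (c * (1 + \<bar>r\<bar>) powr - q) = c * (?V * r ^ (?n - 1) * (1 + \<bar>r\<bar>) powr - q)"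
          by (simp only: mult_ac)
        also have "\<dots> \<le> \<bar>c\<bar> * (?V * r ^ (?n - 1) * (1 + \<bar>r\<bar>) powr - q)"
          using True by (intro mult_right_mono) auto
        finally show ?thesis by (simp only: mult_ac)
      qed
      ultimately show ?thesis
        using True by (simp add: ennreal_mult'[symmetric] ennreal_leI)
    qed simp
  qed
  also have "\<dots> = ennreal (?V * \<bar>c\<bar>) * (\<integral>\<^sup>+r. ennreal ((1 + \<bar>r\<bar>) powr - (q - real (?n - 1))) \<partial>lborel)"
    by (rule nn_integral_cmult) measurable
  also have "\<dots> < \<infinity>"
    using nn_integral_one_plus_abs_powr_finite[of "q - real (?n - 1)"] assms
    by (auto simp: ennreal_mult_less_top of_nat_diff Suc_leI)
  finally show ?thesis .
qed

text \<open>Dominated convergence. For |x| <= k/2 the gain 1/(1 + |r - k|) is at most 2/k and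
  cancels the factor k; the majorant, a multiple of (1 + |x|)^(-(n-1)p/2), is integrable by the
  second condition on p. Pointwise convergence comes from the decay T^(-2).\<close>

lemma nn_integral_near_tendsto_0:
  assumes n: "4 \<le> DIM('a::euclidean_space)"
    and p: "0 < p" "real DIM('a) < (real DIM('a) - 1) / 2 * p"
  shows "(\<lambda>k. \<integral>\<^sup>+(x::'a). ennreal ((real k * norm (focusing_data (real k) x)) powr p)
      * indicator {x. norm x \<le> real k / 2} x \<partial>lborel) \<longlonglongrightarrow> 0"
proof -
  let ?f = "\<lambda>k x::'a. focusing_data (real k) x"
  define b where "b = (real DIM('a) - 1) / 2"
  have n2: "2 \<le> DIM('a)" using n by simp
  have b: "0 < b" using n by (simp add: b_def)
  obtain C where C: "0 \<le> C"
    "\<And>T x. 0 < T \<Longrightarrow> T\<^sup>2 * norm (focusing_data T (x::'a)) \<le> C * (1 + (norm x)\<^sup>2)\<^sup>2"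
    "\<And>T x. 0 < T \<Longrightarrow> x \<noteq> 0 \<Longrightarrow> norm (focusing_data T (x::'a)) \<le> C * norm x powr - b / (1 + \<bar>norm x - T\<bar>)"
    using focusing_data_bounds[OF n2] unfolding b_def by blast
  \<comment> \<open>The 4 bounds (1 + |x|^2)^2 on the unit ball. The factor \<open>2 powr b\<close>
    pays for passing to 1 + |x|, which is at most 2 inside the ball and at most 2|x|
    outside.\<close>
  define C' where "C' = 4 * C * 2 powr b"
  have C': "0 \<le> C'" using C by (simp add: C'_def)
  have [measurable]: "focusing_data T \<in> borel_measurable (borel :: 'a measure)" for T
    by (rule borel_measurable_continuous_onI[OF continuous_on_focusing_data[OF n2]])
  have small: "real k * norm (?f k x) \<le> C * (1 + (norm x)\<^sup>2)\<^sup>2 / real k" if "0 < k" for k x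
    using C(2)[of "real k" x] that by (simp add: field_simps power2_eq_square)
  have bound: "real k * norm (?f k x) \<le> C' * (1 + norm x) powr - b" if k: "0 < k" and x: "norm x \<le> real k / 2" for k x
  proof (cases "norm x \<le> 1")
    case True
    have "(norm x)\<^sup>2 \<le> 1" using True by (simp add: abs_square_le_1)
    then have "(1 + (norm x)\<^sup>2)\<^sup>2 \<le> 2\<^sup>2" by (intro power_mono) auto
    then have "C * (1 + (norm x)\<^sup>2)\<^sup>2 / real k \<le> C * 4 / 1"
      using k C(1) by (intro frac_le mult_left_mono) auto
    with small[OF k, of x] have "real k * norm (?f k x) \<le> 4 * C * 1" by simp
    also have "1 \<le> 2 powr b * (1 + norm x) powr - b"
    proof -
      have "(1 + norm x) powr b \<le> 2 powr b" using True b by (intro powr_mono2) auto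
      moreover have "0 < (1 + norm x) powr b"
        using add_pos_nonneg[of 1 "norm x"] by simp
      ultimately show ?thesis
        by (simp add: powr_minus flip: divide_inverse)
    qed
    then have "4 * C * 1 \<le> 4 * C * (2 powr b * (1 + norm x) powr - b)"
      using C(1) by (intro mult_left_mono) auto
    finally show ?thesis by (simp add: C'_def)
  next
    case False
    have "real k * norm (?f k x) \<le> real k * (C * norm x powr - b / (1 + \<bar>norm x - real k\<bar>))"
      using False k by (intro mult_left_mono C(3)) auto
    also have "\<dots> \<le> real k * (C * norm x powr - b / (real k / 2))"
      using k x C(1) by (intro mult_left_mono divide_left_mono) auto
    also have "\<dots> = 2 * C * norm x powr - b" using k by simp
    also have "norm x powr - b \<le> ((1 + norm x) / 2) powr - b"
      using False b by (intro powr_mono2') auto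
    also have "((1 + norm x) / 2) powr - b = 2 powr b * (1 + norm x) powr - b"
      by (simp add: powr_divide powr_minus divide_simps)
    finally have "real k * norm (?f k x) \<le> 2 * C * (2 powr b * (1 + norm x) powr - b)"
      using C(1) by (simp add: mult_left_mono)
    also have "\<dots> \<le> 4 * C * (2 powr b * (1 + norm x) powr - b)"
      using C(1) by (intro mult_right_mono) auto
    finally show ?thesis by (simp add: C'_def)
  qed
  have "(\<lambda>k. \<integral>\<^sup>+(x::'a). ennreal ((real k * norm (?f k x)) powr p) * indicator {x. norm x \<le> real k / 2} x \<partial>lborel)
      \<longlonglongrightarrow> (\<integral>\<^sup>+(x::'a). 0 \<partial>lborel)"
  proof (rule nn_integral_dominated_convergence)
    show "AE x in lborel. ennreal ((real k * norm (?f k x)) powr p) * indicator {x. norm x \<le> real k / 2} x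
        \<le> ennreal (C' powr p * (1 + norm x) powr - (b * p))" for k
    proof (intro AE_I2)
      fix x :: 'a
      show "ennreal ((real k * norm (?f k x)) powr p) * indicator {x. norm x \<le> real k / 2} x
        \<le> ennreal (C' powr p * (1 + norm x) powr - (b * p))"
      proof (cases "0 < k \<and> norm x \<le> real k / 2")
        case True
        then have "(real k * norm (?f k x)) powr p \<le> (C' * (1 + norm x) powr - b) powr p"
          using p bound by (intro powr_mono2) auto
        also have "\<dots> = C' powr p * (1 + norm x) powr - (b * p)"
          using C' by (simp add: powr_mult powr_powr)
        finally show ?thesis using True by (simp add: ennreal_leI)
      qed auto
    qed
    show "(\<integral>\<^sup>+(x::'a). ennreal (C' powr p * (1 + norm x) powr - (b * p)) \<partial>lborel) < \<infinity>"
      by (rule nn_integral_radial_powr_finite) (use p in \<open>simp add: b_def\<close>)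
    show "AE x in lborel. (\<lambda>k. ennreal ((real k * norm (?f k x)) powr p) * indicator {x. norm x \<le> real k / 2} x) \<longlonglongrightarrow> 0"
    proof (intro AE_I2)
      fix x :: 'a
      have "(\<lambda>k. real k * norm (?f k x)) \<longlonglongrightarrow> 0"
      proof (rule tendsto_sandwich[where f = "\<lambda>_. 0"])
        show "\<forall>\<^sub>F k in sequentially. real k * norm (?f k x) \<le> C * (1 + (norm x)\<^sup>2)\<^sup>2 / real k"
          using eventually_gt_at_top[of 0] by eventually_elim (rule small)
        show "(\<lambda>k. C * (1 + (norm x)\<^sup>2)\<^sup>2 / real k) \<longlonglongrightarrow> 0"
          by (rule lim_const_over_n)
      qed auto
      then have "(\<lambda>k. (real k * norm (?f k x)) powr p) \<longlonglongrightarrow> 0"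
        using p by (intro tendsto_zero_powrI[where b = p]) auto
      then have 0: "(\<lambda>k. ennreal ((real k * norm (?f k x)) powr p)) \<longlonglongrightarrow> 0"
        by (simp add: tendsto_ennreal_iff flip: ennreal_0)
      show "(\<lambda>k. ennreal ((real k * norm (?f k x)) powr p) * indicator {x. norm x \<le> real k / 2} x) \<longlonglongrightarrow> 0"
        by (rule tendsto_sandwich[OF _ _ tendsto_const 0]) (auto simp: indicator_def)
    qed
  qed measurable
  then show ?thesis by simp
qed

text \<open>Here k < 2|x|, so k is absorbed into the power of |x|. With the volume factor r^(n-1)
  the powers of r combine to r^(-\<epsilon>), at most (k/2)^(-\<epsilon>); what is left, (1 + |r -
  k|)^(-p), has a finite integral independent of k.\<close>

lemma nn_integral_far_tendsto_0:
  assumes n: "4 \<le> DIM('a::euclidean_space)"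
    and p: "1 < p" "real DIM('a) - 1 < (real DIM('a) - 3) / 2 * p"
  shows "(\<lambda>k. \<integral>\<^sup>+(x::'a). ennreal ((real k * norm (focusing_data (real k) x)) powr p)
      * indicator {x. real k / 2 < norm x} x \<partial>lborel) \<longlonglongrightarrow> 0"
proof -
  let ?f = "\<lambda>k x::'a. focusing_data (real k) x"
  let ?n = "DIM('a)" and ?V = "unit_ball_vol DIM('a) * DIM('a)"
  define b where "b = (real DIM('a) - 1) / 2"
  \<comment> \<open>Since b - 1 = (n-3)/2, positivity of \<epsilon> is exactly the threshold p >
    2(n-1)/(n-3).\<close>
  define \<epsilon> where "\<epsilon> = (b - 1) * p - (real ?n - 1)"
  have \<epsilon>: "0 < \<epsilon>" using p by (simp add: \<epsilon>_def b_def field_simps)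
  have n2: "2 \<le> DIM('a)" using n by simp
  obtain C where C: "0 \<le> C"
    "\<And>T x. 0 < T \<Longrightarrow> T\<^sup>2 * norm (focusing_data T (x::'a)) \<le> C * (1 + (norm x)\<^sup>2)\<^sup>2"
    "\<And>T x. 0 < T \<Longrightarrow> x \<noteq> 0 \<Longrightarrow> norm (focusing_data T (x::'a)) \<le> C * norm x powr - b / (1 + \<bar>norm x - T\<bar>)"
    using focusing_data_bounds[OF n2] unfolding b_def by blast
  define J where "J = (\<integral>\<^sup>+y. ennreal ((1 + \<bar>y\<bar>) powr - p) \<partial>lborel)"
  have J: "J < \<infinity>" unfolding J_def by (rule nn_integral_one_plus_abs_powr_finite[OF p(1)])
  have le: "(\<integral>\<^sup>+(x::'a). ennreal ((real k * norm (?f k x)) powr p) * indicator {x. real k / 2 < norm x} x \<partial>lborel)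
      \<le> ennreal (?V * (2 * C) powr p * (real k / 2) powr - \<epsilon>) * J" if k: "0 < k" for k
  proof -
    let ?h = "\<lambda>r. ennreal ((2 * C * r powr (1 - b) / (1 + \<bar>r - real k\<bar>)) powr p) * indicator {real k / 2 <..} r"
    have "(\<integral>\<^sup>+(x::'a). ennreal ((real k * norm (?f k x)) powr p) * indicator {x. real k / 2 < norm x} x \<partial>lborel)
        \<le> (\<integral>\<^sup>+(x::'a). ?h (norm x) \<partial>lborel)"
    proof (rule nn_integral_mono)
      fix x :: 'a
      show "ennreal ((real k * norm (?f k x)) powr p) * indicator {x. real k / 2 < norm x} x \<le> ?h (norm x)"
      proof (cases "real k / 2 < norm x")
        case True
        then have x: "0 < norm x" using k by (smt (verit) divide_nonneg_nonneg of_nat_0_le_iff)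
        have "real k * norm (?f k x) \<le> (2 * norm x) * (C * norm x powr - b / (1 + \<bar>norm x - real k\<bar>))"
          using True k x C by (intro mult_mono C(3)) auto
        also have "\<dots> = 2 * C * (norm x * norm x powr - b) / (1 + \<bar>norm x - real k\<bar>)"
          by simp
        also have "norm x * norm x powr - b = norm x powr (1 - b)"
          using x by (simp add: powr_mult_base)
        finally have "(real k * norm (?f k x)) powr p \<le> (2 * C * norm x powr (1 - b) / (1 + \<bar>norm x - real k\<bar>)) powr p"
          using p by (intro powr_mono2) auto
        then show ?thesis using True by (simp add: ennreal_leI)
      qed simp
    qed
    also have "\<dots> = (\<integral>\<^sup>+r. ennreal (?V * r ^ (?n - 1) * indicator {0..} r) * ?h r \<partial>lborel)"
      by (rule nn_integral_radial) measurable
    also have "\<dots> \<le> (\<integral>\<^sup>+r. ennreal (?V * (2 * C) powr p * (real k / 2) powr - \<epsilon>) * ennreal ((1 + \<bar>r - real k\<bar>) powr - p) \<partial>lborel)"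
    proof (rule nn_integral_mono)
      fix r :: real
      show "ennreal (?V * r ^ (?n - 1) * indicator {0..} r) * ?h r
          \<le> ennreal (?V * (2 * C) powr p * (real k / 2) powr - \<epsilon>) * ennreal ((1 + \<bar>r - real k\<bar>) powr - p)"
      proof (cases "real k / 2 < r")
        case True
        then have r: "0 < r" using k by (smt (verit) divide_nonneg_nonneg of_nat_0_le_iff)
        have "r ^ (?n - 1) = r powr (real ?n - 1)"
          using r n by (simp add: of_nat_diff flip: powr_realpow)
        moreover have "(2 * C * r powr (1 - b) / (1 + \<bar>r - real k\<bar>)) powr p
            = (2 * C) powr p * r powr ((1 - b) * p) * (1 + \<bar>r - real k\<bar>) powr - p"
          using C(1) r by (simp add: powr_mult powr_powr powr_minus divide_inverse inverse_powr)
        ultimately have "?V * r ^ (?n - 1) * (2 * C * r powr (1 - b) / (1 + \<bar>r - real k\<bar>)) powr p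
            = ?V * (2 * C) powr p * (r powr (real ?n - 1) * r powr ((1 - b) * p)) * (1 + \<bar>r - real k\<bar>) powr - p"
          by (simp only: mult_ac)
        also have "r powr (real ?n - 1) * r powr ((1 - b) * p) = r powr - \<epsilon>"
          unfolding powr_add[symmetric] by (simp add: \<epsilon>_def algebra_simps)
        also have "?V * (2 * C) powr p * r powr - \<epsilon> * (1 + \<bar>r - real k\<bar>) powr - p
            \<le> ?V * (2 * C) powr p * (real k / 2) powr - \<epsilon> * (1 + \<bar>r - real k\<bar>) powr - p"
          using True k \<epsilon> by (intro mult_right_mono mult_left_mono powr_mono2') auto
        finally show ?thesis
          using True r by (simp add: ennreal_mult'[symmetric] ennreal_leI)
      qed simp
    qed
    also have "\<dots> = ennreal (?V * (2 * C) powr p * (real k / 2) powr - \<epsilon>) * (\<integral>\<^sup>+r. ennreal ((1 + \<bar>r - real k\<bar>) powr - p) \<partial>lborel)"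
      by (rule nn_integral_cmult) measurable
    also have "(\<integral>\<^sup>+r. ennreal ((1 + \<bar>r - real k\<bar>) powr - p) \<partial>lborel) = J"
      unfolding J_def by (subst nn_integral_real_affine[where c = 1 and t = "real k"]) auto
    finally show ?thesis .
  qed
  have "(\<lambda>k. (real k / 2) powr - \<epsilon>) \<longlonglongrightarrow> 0"
    using \<epsilon> by real_asymp
  then have "(\<lambda>k. ?V * (2 * C) powr p * (real k / 2) powr - \<epsilon>) \<longlonglongrightarrow> ?V * (2 * C) powr p * 0"
    by (intro tendsto_mult tendsto_const)
  then have "(\<lambda>k. ennreal (?V * (2 * C) powr p * (real k / 2) powr - \<epsilon>)) \<longlonglongrightarrow> 0"
    by (simp add: tendsto_ennreal_iff flip: ennreal_0)
  then have "(\<lambda>k. ennreal (?V * (2 * C) powr p * (real k / 2) powr - \<epsilon>) * J) \<longlonglongrightarrow> 0 * J"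
    using J by (intro tendsto_mult_ennreal tendsto_const) auto
  then have lim: "(\<lambda>k. ennreal (?V * (2 * C) powr p * (real k / 2) powr - \<epsilon>) * J) \<longlonglongrightarrow> 0" by simp
  show ?thesis
  proof (rule tendsto_sandwich[OF _ _ tendsto_const lim])
    show "\<forall>\<^sub>F k in sequentially. (\<integral>\<^sup>+(x::'a). ennreal ((real k * norm (?f k x)) powr p) * indicator {x. real k / 2 < norm x} x \<partial>lborel)
      \<le> ennreal (?V * (2 * C) powr p * (real k / 2) powr - \<epsilon>) * J"
      using eventually_gt_at_top[of 0] by eventually_elim (rule le)
  qed auto
qed

lemma nn_integral_focusing_data_tendsto_0:
  assumes n: "4 \<le> DIM('a::euclidean_space)"
    and p: "p > 2 * (real DIM('a) - 1) / (real DIM('a) - 3)"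
  shows "(\<lambda>k. \<integral>\<^sup>+(x::'a). ennreal ((real k * norm (focusing_data (real k) x)) powr p) \<partial>lborel) \<longlonglongrightarrow> 0"
proof -
  let ?f = "\<lambda>k x::'a. focusing_data (real k) x"
  let ?n = "real DIM('a)"
  have n': "0 < ?n - 3" using n by simp
  have p1: "?n - 1 < (?n - 3) / 2 * p"
    using p n' by (simp add: field_simps)
  have p2: "2 < p"
  proof -
    have "2 \<le> 2 * (?n - 1) / (?n - 3)" using n' by (simp add: field_simps)
    then show ?thesis using p by linarith
  qed
  \<comment> \<open>The number (n-1)p/2 exceeds (n-3)p/2 by p > 2, so the inner condition follows
    from the threshold.\<close>
  have p3: "?n < (?n - 1) / 2 * p"
    using p1 p2 by (simp add: field_simps)
  have n2: "2 \<le> DIM('a)" using n by simp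
  have [measurable]: "focusing_data T \<in> borel_measurable (borel :: 'a measure)" for T
    by (rule borel_measurable_continuous_onI[OF continuous_on_focusing_data[OF n2]])
  have "(\<integral>\<^sup>+(x::'a). ennreal ((real k * norm (?f k x)) powr p) \<partial>lborel)
      = (\<integral>\<^sup>+(x::'a). ennreal ((real k * norm (?f k x)) powr p) * indicator {x. norm x \<le> real k / 2} x \<partial>lborel)
      + (\<integral>\<^sup>+(x::'a). ennreal ((real k * norm (?f k x)) powr p) * indicator {x. real k / 2 < norm x} x \<partial>lborel)" for k
    by (subst nn_integral_add[symmetric]) (auto intro!: nn_integral_cong simp: indicator_def)
  moreover have "(\<lambda>k. (\<integral>\<^sup>+(x::'a). ennreal ((real k * norm (?f k x)) powr p) * indicator {x. norm x \<le> real k / 2} x \<partial>lborel)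
      + (\<integral>\<^sup>+(x::'a). ennreal ((real k * norm (?f k x)) powr p) * indicator {x. real k / 2 < norm x} x \<partial>lborel)) \<longlonglongrightarrow> 0 + 0"
    by (intro tendsto_add nn_integral_near_tendsto_0 nn_integral_far_tendsto_0 n p1 p3) (use p2 in auto)
  ultimately show ?thesis by simp
qed

text \<open>At t = T the first phase is 0 and nothing oscillates: at the origin this half has
  modulus 1/2 times the total mass of the weight. The mirror image has phase -2T and is O(1/T) on
  bounded sets.\<close>

lemma focusing_lower_bound:
  assumes "2 \<le> DIM('a::euclidean_space)"
  obtains c \<delta> T0 where "0 < c" "0 < \<delta>"
    "\<And>T x. T0 \<le> T \<Longrightarrow> x \<in> ball (0::'a) \<delta> \<Longrightarrow> c \<le> norm (focusing T x T)"
proof -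
  define a where "a = real DIM('a) / 2"
  have a: "1 \<le> a" using assms by (simp add: a_def)
  let ?g = "\<lambda>x::'a. bwave a 0 (x \<bullet> x) 0"
  have "C_k 0 ?g" using schwartz_bwave[OF a] unfolding schwartz_def by blast
  then have "isCont ?g 0" by (simp add: continuous_on_eq_continuous_at)
  have g0: "bwave a 0 0 0 = of_real (moment 0)"
    by (simp add: bwave_def moment_def scaleR_conv_of_real)
  have m: "0 < moment 0"
  proof (rule ccontr)
    assume "\<not> 0 < moment 0"
    then have "moment 0 = 0" using moment_nonneg[of 0] by linarith
    then have "(\<integral>l. (1::real) \<partial>wmeasure) = 0" by (simp add: moment_def)
    then have "AE l in wmeasure. (1::real) = 0"
      using integrable_moment[of 0] by (subst (asm) integral_nonneg_eq_0_iff_AE) auto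
    then have "AE l in lborel. 0 < weight l \<longrightarrow> False"
      unfolding wmeasure_def by (subst (asm) AE_density) auto
    then have "AE l in lborel. l \<notin> {0<..<1::real}"
      by eventually_elim (auto simp: weight_def)
    then have "{0<..<1::real} \<in> null_sets lborel"
      by (subst AE_iff_null_sets) auto
    from null_setsD1[OF this] show False by simp
  qed
  obtain \<delta>1 where \<delta>1: "0 < \<delta>1" "\<And>x::'a. norm x < \<delta>1 \<Longrightarrow> norm (?g x - ?g 0) < moment 0 / 2"
    using \<open>isCont ?g 0\<close> m unfolding continuous_at_eps_delta dist_norm
    by (metis diff_zero half_gt_zero)
  obtain C where C: "0 \<le> C" "\<And>s t. 0 \<le> s \<Longrightarrow> \<bar>t\<bar> * norm (bwave a 0 s t) \<le> C * (1 + s)"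
    using bwave_time_decay[OF a] by blast
  show ?thesis
  \<comment> \<open>With mass m, continuity keeps the focusing term above m/2, and T >= 4C/m keeps
    the mirror image below m/4, as |x| < 1 bounds 1 + |x|^2 by 2; half the difference is m/8. The
    summand 1 makes T positive.\<close>
  proof (rule that[of "moment 0 / 8" "min \<delta>1 1" "4 * C / moment 0 + 1"])
    fix T :: real and x :: 'a assume T: "4 * C / moment 0 + 1 \<le> T" and x: "x \<in> ball 0 (min \<delta>1 1)"
    have T0: "0 < T" using T C(1) m by (smt (verit) divide_nonneg_pos)
    have "norm (?g x) \<ge> moment 0 / 2"
    proof -
      have "norm (?g 0) - norm (?g x) \<le> norm (?g x - ?g 0)"
        by (metis norm_minus_commute norm_triangle_ineq2)
      also have "\<dots> < moment 0 / 2" using x by (intro \<delta>1) auto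
      finally show ?thesis using m by (simp add: g0)
    qed
    moreover have "norm (bwave a 0 (x \<bullet> x) (- T - T)) \<le> moment 0 / 4"
    proof -
      have "(norm x)\<^sup>2 \<le> 1" using x by (simp add: abs_square_le_1)
      then have "x \<bullet> x \<le> 1" by (simp add: power2_norm_eq_inner)
      have "\<bar>- T - T\<bar> * norm (bwave a 0 (x \<bullet> x) (- T - T)) \<le> C * (1 + x \<bullet> x)"
        by (rule C(2)) simp
      also have "\<dots> \<le> C * 2" using C(1) \<open>x \<bullet> x \<le> 1\<close> by (intro mult_left_mono) auto
      finally have 1: "T * norm (bwave a 0 (x \<bullet> x) (- T - T)) \<le> C" using T0 by simp
      have "4 * C \<le> T * moment 0" using T m by (simp add: field_simps)
      with 1 have "T * norm (bwave a 0 (x \<bullet> x) (- T - T)) \<le> T * (moment 0 / 4)" by simp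
      then show ?thesis using T0 by simp
    qed
    moreover have "norm (focusing T x T) = norm (?g x - bwave a 0 (x \<bullet> x) (- T - T)) / 2"
    proof -
      have "focusing T x T = - \<i> / 2 * (?g x - bwave a 0 (x \<bullet> x) (- T - T))"
        by (simp add: focusing_def a_def right_diff_distrib)
      then show ?thesis by (simp only: norm_mult norm_divide norm_minus_cancel) simp
    qed
    moreover have "norm (?g x) - norm (bwave a 0 (x \<bullet> x) (- T - T)) \<le> norm (?g x - bwave a 0 (x \<bullet> x) (- T - T))"
      by (rule norm_triangle_ineq2)
    ultimately show "moment 0 / 8 \<le> norm (focusing T x T)" by simp
  qed (use m \<delta>1 in auto)
qed

section \<open>Comparison of the two L^p norms\<close>

lemma ennreal_powr_ennreal: "0 \<le> y \<Longrightarrow> ennreal_powr (ennreal y) a = ennreal (y powr a)"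
  by (simp add: ennreal_powr_def)

lemma ennreal_powr_mono:
  assumes "0 \<le> a" "y \<le> z"
  shows "ennreal_powr y a \<le> ennreal_powr z a"
proof (cases "z = top")
  case False
  then have "y < top" using assms(2) by (simp add: top.not_eq_extremum order_le_less_trans)
  then show ?thesis
    using assms False
    by (auto simp: ennreal_powr_def top.not_eq_extremum intro!: ennreal_leI powr_mono2 enn2real_mono)
qed (simp add: ennreal_powr_def)

text \<open>The map \<open>ennreal\<close> sends negative numbers to 0, hence
  \<open>max C 0\<close>. Finiteness of the integral of G makes both sides real, so that the p-th
  power can be taken with \<open>powr\<close>.\<close>

lemma Lp_norm_leD:
  assumes p: "0 < p" and le: "Lp_norm p F \<le> ennreal C * Lp_norm p G"
    and fin: "(\<integral>\<^sup>+x. ennreal_powr (G x) p \<partial>lborel) < \<infinity>"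
  shows "(\<integral>\<^sup>+x. ennreal_powr (F x) p \<partial>lborel) \<le> ennreal (max C 0 powr p) * (\<integral>\<^sup>+x. ennreal_powr (G x) p \<partial>lborel)"
proof -
  obtain Y where Y: "0 \<le> Y" "(\<integral>\<^sup>+x. ennreal_powr (G x) p \<partial>lborel) = ennreal Y"
    using fin by (cases "\<integral>\<^sup>+x. ennreal_powr (G x) p \<partial>lborel") auto
  define X where "X = (\<integral>\<^sup>+x. ennreal_powr (F x) p \<partial>lborel)"
  have "ennreal_powr X (1 / p) \<le> ennreal C * ennreal (Y powr (1 / p))"
    using le unfolding Lp_norm_def X_def[symmetric] Y(2) ennreal_powr_ennreal[OF Y(1)] .
  also have "\<dots> \<le> ennreal (max C 0) * ennreal (Y powr (1 / p))"
    by (intro mult_right_mono ennreal_leI) auto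
  finally have "ennreal_powr X (1 / p) \<le> ennreal (max C 0) * ennreal (Y powr (1 / p))" .
  then have X: "ennreal_powr X (1 / p) \<le> ennreal (max C 0 * Y powr (1 / p))"
    by (simp add: ennreal_mult)
  then have "X \<noteq> top" by (auto simp: ennreal_powr_def top_unique)
  then obtain x where x: "0 \<le> x" "X = ennreal x" by (cases X) auto
  have "x powr (1 / p) \<le> max C 0 * Y powr (1 / p)"
    using X by (simp add: x ennreal_powr_ennreal)
  then have "(x powr (1 / p)) powr p \<le> (max C 0 * Y powr (1 / p)) powr p"
    using p by (intro powr_mono2) auto
  then have "x \<le> max C 0 powr p * Y"
    using p x(1) Y(1) by (simp add: powr_powr powr_mult)
  then show ?thesis
    unfolding X_def[symmetric] Y(2) x(2) using Y(1) by (simp add: ennreal_leI flip: ennreal_mult)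
qed

theorem corollary1p2:
  fixes p :: real
  assumes "CARD('n::finite) \<ge> 4"
    and "p > 2 * (real CARD('n) - 1) / (real CARD('n) - 3)"
  shows "\<not> (\<exists>C::real. \<forall>(f :: real ^ 'n \<Rightarrow> complex) (u :: real ^ 'n \<Rightarrow> real \<Rightarrow> complex).
           schwartz f \<longrightarrow> wave_solution f u \<longrightarrow>
           Lp_norm p (\<lambda>x. SUP t\<in>{0<..}. ennreal (norm (u x t / complex_of_real t)))
             \<le> ennreal C * Lp_norm p (\<lambda>x. ennreal (norm (f x))))"
proof
  let ?f = "\<lambda>k x::real ^ 'n. focusing_data (real k) x"
  assume "\<exists>C::real. \<forall>(f :: real ^ 'n \<Rightarrow> complex) (u :: real ^ 'n \<Rightarrow> real \<Rightarrow> complex).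
           schwartz f \<longrightarrow> wave_solution f u \<longrightarrow>
           Lp_norm p (\<lambda>x. SUP t\<in>{0<..}. ennreal (norm (u x t / complex_of_real t)))
             \<le> ennreal C * Lp_norm p (\<lambda>x. ennreal (norm (f x)))"
  then obtain C :: real where C: "\<And>f u. schwartz f \<Longrightarrow> wave_solution f u \<Longrightarrow>
           Lp_norm p (\<lambda>x::real ^ 'n. SUP t\<in>{0<..}. ennreal (norm (u x t / complex_of_real t)))
             \<le> ennreal C * Lp_norm p (\<lambda>x. ennreal (norm (f x)))"
    by blast
  have n: "4 \<le> DIM(real ^ 'n)" and n2: "2 \<le> DIM(real ^ 'n)"
    using assms(1) by auto
  have p0: "0 < p"
  proof -
    have "0 < 2 * (real CARD('n) - 1) / (real CARD('n) - 3)" using assms(1) by simp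
    then show ?thesis using assms(2) by linarith
  qed
  \<comment> \<open>The focusing time T runs through the integers k; \<open>I k\<close> is the p-th
    power of T times the norm of the data.\<close>
  define I where "I k = (\<integral>\<^sup>+x. ennreal ((real k * norm (?f k x)) powr p) \<partial>lborel)" for k
  have I: "I \<longlonglongrightarrow> 0"
    unfolding I_def using nn_integral_focusing_data_tendsto_0[OF n, of p] assms(2) by simp
  obtain c \<delta> T0 where c: "0 < c" "0 < \<delta>"
    "\<And>T x. T0 \<le> T \<Longrightarrow> x \<in> ball (0::real ^ 'n) \<delta> \<Longrightarrow> c \<le> norm (focusing T x T)"
    using focusing_lower_bound[OF n2] by blast
  define L where "L = ennreal (c powr p) * emeasure lborel (ball (0::real ^ 'n) \<delta>)"
  have [measurable]: "focusing_data T \<in> borel_measurable (borel :: (real ^ 'n) measure)" for T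
    by (rule borel_measurable_continuous_onI[OF continuous_on_focusing_data[OF n2]])
  \<comment> \<open>The condition \<open>I k < 1\<close> ensures that the data have finite norm.
    Multiplying both sides by k^p undoes the division by t at t = k, so that \<open>L\<close> does
    not depend on k.\<close>
  have main: "L \<le> ennreal (max C 0 powr p) * I k" if k: "T0 \<le> real k" "0 < k" "I k < 1" for k
  proof -
    let ?S = "\<lambda>x::real ^ 'n. SUP t\<in>{0<..}. ennreal (norm (focusing (real k) x t / complex_of_real t))"
    let ?T = "ennreal (real k powr p)"
    have Ik: "I k = ?T * (\<integral>\<^sup>+x. ennreal_powr (ennreal (norm (?f k x))) p \<partial>lborel)"
      unfolding I_def by (subst nn_integral_cmult[symmetric])
        (auto intro!: nn_integral_cong simp: ennreal_powr_ennreal powr_mult ennreal_mult)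
    have fin: "(\<integral>\<^sup>+x. ennreal_powr (ennreal (norm (?f k x))) p \<partial>lborel) < \<infinity>"
    proof (rule ccontr)
      assume "\<not> ?thesis"
      then have "(\<integral>\<^sup>+x. ennreal_powr (ennreal (norm (?f k x))) p \<partial>lborel) = top"
        by (metis infinity_ennreal_def top.not_eq_extremum)
      then have "I k = top" unfolding Ik using k(2) by (simp add: ennreal_mult_eq_top_iff)
      then show False using k(3) by simp
    qed
    have "L = ?T * (ennreal ((c / real k) powr p) * emeasure lborel (ball (0::real ^ 'n) \<delta>))"
      using c(1) k(2) by (simp add: L_def powr_divide flip: ennreal_mult mult.assoc)
    also have "\<dots> = ?T * (\<integral>\<^sup>+x. ennreal ((c / real k) powr p) * indicator (ball (0::real ^ 'n) \<delta>) x \<partial>lborel)"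
      by (simp add: nn_integral_cmult_indicator)
    \<comment> \<open>The value at t = k bounds the supremum from below; the integral is monotone
      for arbitrary functions, so the supremum over uncountably many t does no harm.\<close>
    also have "\<dots> \<le> ?T * (\<integral>\<^sup>+x. ennreal_powr (?S x) p \<partial>lborel)"
    proof (intro mult_left_mono nn_integral_mono)
      fix x :: "real ^ 'n"
      show "ennreal ((c / real k) powr p) * indicator (ball 0 \<delta>) x \<le> ennreal_powr (?S x) p"
      proof (cases "x \<in> ball 0 \<delta>")
        case True
        have "ennreal (c / real k) \<le> ennreal (norm (focusing (real k) x (real k) / complex_of_real (real k)))"
          using c(3)[OF k(1) True] by (auto intro!: ennreal_leI divide_right_mono simp: norm_divide)
        also have "\<dots> \<le> ?S x" using k(2) by (intro SUP_upper) auto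
        finally have "ennreal_powr (ennreal (c / real k)) p \<le> ennreal_powr (?S x) p"
          using p0 by (intro ennreal_powr_mono) auto
        then show ?thesis using True c(1) by (simp add: ennreal_powr_ennreal)
      qed simp
    qed simp
    also have "\<dots> \<le> ?T * (ennreal (max C 0 powr p) * (\<integral>\<^sup>+x. ennreal_powr (ennreal (norm (?f k x))) p \<partial>lborel))"
      by (intro mult_left_mono Lp_norm_leD p0 fin C schwartz_focusing_data wave_solution_focusing n2) auto
    also have "\<dots> = ennreal (max C 0 powr p) * I k"
      unfolding Ik by (simp only: mult_ac)
    finally show ?thesis .
  qed
  have "unit_ball_vol (real CARD('n)) \<noteq> 0"
    using unit_ball_vol_pos[of "real CARD('n)"] by linarith
  then have "0 < L"
    using c by (simp add: L_def ennreal_zero_less_mult_iff emeasure_ball zero_less_iff_neq_zero)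
  moreover have "L \<le> 0"
  proof (rule tendsto_lowerbound)
    have "(\<lambda>k. ennreal (max C 0 powr p) * I k) \<longlonglongrightarrow> ennreal (max C 0 powr p) * 0"
      by (intro tendsto_mult_ennreal tendsto_const I) auto
    then show "(\<lambda>k. ennreal (max C 0 powr p) * I k) \<longlonglongrightarrow> 0" by simp
    have "\<forall>\<^sub>F k in sequentially. I k < 1"
      using I by (rule order_tendstoD) simp
    moreover have "\<forall>\<^sub>F k in sequentially. T0 \<le> real k"
      using filterlim_real_sequentially by (simp add: filterlim_at_top)
    ultimately show "\<forall>\<^sub>F k in sequentially. L \<le> ennreal (max C 0 powr p) * I k"
      using eventually_gt_at_top[of 0] by eventually_elim (rule main)
  qed simp
  ultimately show False by simp
qed

end
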